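(* Let $K$ be an imaginary quadratic field, $f_\rho$ a positive integer, $\underline{\mathfrak c}=f_\rho\sqrt{D_K}\mathcal O_K$, and let $\varphi$ be a Hecke character of $K$ of infinity type $[-1/2;1,0]$ whose conductor $\mathfrak c_f$ divides $\underline{\mathfrak c}$. Then the Hecke theta function $\vartheta(\tau;\varphi)$ can be written as a linear combination of the functions $f_a(\tau;\beta)$ ($a=1,\dots,h$, $\beta\in G_{\Lambda_a}$) in which the coefficient of $f_a(\tau;\beta)$ is zero unless $\beta\in\mathrm{orb}^a_{\mathfrak q}$ for some integral ideal $\mathfrak q$ with $\mathfrak q\mid\underline{\mathfrak c}$ and $\mathfrak q+\mathfrak c_f=\mathcal O_K$ (equivalently, $\mathfrak q$ divides $\mathfrak q_{p.\mathfrak c_f}:=\prod_{i:\mathfrak p_i\nmid\mathfrak c_f}\mathfrak p_i^{n_i}$, where $\underline{\mathfrak c}=\prod_i\mathfrak p_i^{n_i}$ is the prime factorization).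
   Context: Embed $K\subset\mathbb C$ with $\sqrt{D_K}$ in the upper half plane $\mathcal H$; $D_K<0$ the discriminant, $h$ the class number. Hecke character of infinity type $[-1/2;1,0]$ with conductor $\mathfrak c_f$: a homomorphism $\varphi$ from fractional ideals prime to $\mathfrak c_f$ to $\mathbb C^\times$ with $\varphi(\alpha\mathcal O_K)=\alpha\chi'_\varphi(\alpha)$ for $\alpha\in\mathcal O_K$ prime to $\mathfrak c_f$, $\chi'_\varphi$ a character of $(\mathcal O_K/\mathfrak c_f)^\times$, $\mathfrak c_f$ minimal. $\vartheta(\tau;\varphi)=\sum_I\varphi(I)e^{2\pi i\tau\mathrm{Nm}(I)}$ over nonzero integral ideals ($\varphi(I)=0$ if $I$ not prime to $\mathfrak c_f$). Let $z_1,\dots,z_h\in\mathcal H$ represent the $\mathbb C$-isomorphism classes of elliptic curves with CM by $\mathcal O_K$, $\mathfrak b_{z_a}=\mathbb Z+z_a\mathbb Z$; for $z=z_a$ let $(a_z,b_z,c_z)$ coprime integers, $a_z>0$, $a_zz^2+b_zz+c_z=0$. $\Lambda_a$: lattice with basis $e_2,e_1$, Gram matrix $f_\rho\begin{pmatrix}2a_z&b_z\\ b_z&2c_z\end{pmatrix}$; $G_{\Lambda_a}=\Lambda_a^\vee/\Lambda_a$; $\Omega'_a$: $\mathbb Q$-linear map with $\Omega'_a(e_2)=\sqrt{2a_zf_\rho}$, $\Omega'_a(e_1)=-\sqrt{2a_zf_\rho}z$; $\Omega_a=i\sqrt{|G_{\Lambda_a}|}(2a_zf_\rho)^{-1/2}\Omega'_a$,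 which satisfies $\Omega_a(\Lambda_a^\vee)=\mathfrak b_{z_a}$, $\Omega_a(\Lambda_a)=\underline{\mathfrak c}\mathfrak b_{z_a}$. $f_a(\tau;\beta)=\sum_{y\in\Lambda_a^\vee,\,y+\Lambda_a=\beta}\Omega'_a(y)e^{\pi if_\rho|D_K|\tau(y,y)}$. For an integral ideal $\mathfrak q\mid\underline{\mathfrak c}$, $\mathrm{orb}^a_{\mathfrak q}$ is the set of $\beta\in G_{\Lambda_a}$ such that the annihilator $\{\alpha\in\mathcal O_K:\alpha\,\Omega_a(\beta)\in\underline{\mathfrak c}\mathfrak b_{z_a}\}$ of $\Omega_a(\beta)\in\mathfrak b_{z_a}/\underline{\mathfrak c}\mathfrak b_{z_a}$ equals $\underline{\mathfrak c}\mathfrak q^{-1}$. *)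

theory Defs
  imports "HOL-Analysis.Analysis" "HOL-Computational_Algebra.Squarefree"
begin

definition fund_disc :: "int \<Rightarrow> bool" where
  "fund_disc D \<longleftrightarrow> D < 0 \<and>
     ((D mod 4 = 1 \<and> squarefree D) \<or>
      (\<exists>m. D = 4 * m \<and> (m mod 4 = 2 \<or> m mod 4 = 3) \<and> squarefree m))"

definition sqrtD :: "int \<Rightarrow> complex" where
  "sqrtD D = \<i> * complex_of_real (sqrt (of_int (- D)))"

definition OK :: "int \<Rightarrow> complex set" where
  "OK D = {of_int m + of_int n * ((of_int D + sqrtD D) / 2) | m n. True}"

definition integral_ideal :: "int \<Rightarrow> complex set \<Rightarrow> bool" where
  "integral_ideal D I \<longleftrightarrow> I \<subseteq> OK D \<and> I \<noteq> {0} \<and> 0 \<in> I \<and>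
     (\<forall>x\<in>I. \<forall>y\<in>I. x + y \<in> I) \<and> (\<forall>r\<in>OK D. \<forall>x\<in>I. r * x \<in> I)"

definition idl_mult :: "complex set \<Rightarrow> complex set \<Rightarrow> complex set" where
  "idl_mult I J = {x. \<forall>M. (0 \<in> M \<and> (\<forall>u\<in>M. \<forall>v\<in>M. u + v \<in> M \<and> - u \<in> M) \<and>
                          (\<forall>u\<in>I. \<forall>v\<in>J. u * v \<in> M)) \<longrightarrow> x \<in> M}"

definition idl_sum :: "complex set \<Rightarrow> complex set \<Rightarrow> complex set" where
  "idl_sum I J = {x + y | x y. x \<in> I \<and> y \<in> J}"

definition principal :: "int \<Rightarrow> complex \<Rightarrow> complex set" where
  "principal D \<alpha> = {\<alpha> * x | x. x \<in> OK D}"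

definition idl_dvd :: "int \<Rightarrow> complex set \<Rightarrow> complex set \<Rightarrow> bool" where
  "idl_dvd D I J \<longleftrightarrow> (\<exists>L. integral_ideal D L \<and> J = idl_mult I L)"

definition coprime_idl :: "int \<Rightarrow> complex set \<Rightarrow> complex set \<Rightarrow> bool" where
  "coprime_idl D I J \<longleftrightarrow> idl_sum I J = OK D"

definition idl_norm :: "int \<Rightarrow> complex set \<Rightarrow> nat" where
  "idl_norm D I = card ((\<lambda>x. {x + y | y. y \<in> I}) ` OK D)"

definition cbar :: "int \<Rightarrow> nat \<Rightarrow> complex set" where
  "cbar D f = principal D (of_nat f * sqrtD D)"

text \<open>phi is given on integral ideals; it is multiplicative and nonzero on integral ideals
  prime to cf (equivalently, a homomorphism on the group of fractional ideals prime to cf).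
  chi is a character of (O_K/cf)^*, and cf is minimal (primitivity).\<close>
definition hecke_char :: "int \<Rightarrow> complex set \<Rightarrow> (complex set \<Rightarrow> complex) \<Rightarrow> bool" where
  "hecke_char D cf \<phi> \<longleftrightarrow> integral_ideal D cf \<and>
     (\<forall>I J. integral_ideal D I \<longrightarrow> integral_ideal D J \<longrightarrow> coprime_idl D I cf \<longrightarrow>
        coprime_idl D J cf \<longrightarrow> \<phi> (idl_mult I J) = \<phi> I * \<phi> J) \<and>
     (\<forall>I. integral_ideal D I \<longrightarrow> coprime_idl D I cf \<longrightarrow> \<phi> I \<noteq> 0) \<and>
     (\<exists>\<psi> :: complex \<Rightarrow> complex.
        (\<forall>\<alpha>\<in>OK D. \<forall>\<beta>\<in>OK D. \<alpha> - \<beta> \<in> cf \<longrightarrow> \<psi> \<alpha> = \<psi> \<beta>) \<and>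
        (\<forall>\<alpha>\<in>OK D. \<forall>\<beta>\<in>OK D. \<psi> (\<alpha> * \<beta>) = \<psi> \<alpha> * \<psi> \<beta>) \<and>
        (\<forall>\<alpha>\<in>OK D. coprime_idl D (principal D \<alpha>) cf \<longrightarrow> \<psi> \<alpha> \<noteq> 0) \<and>
        (\<forall>\<alpha>\<in>OK D. \<alpha> \<noteq> 0 \<longrightarrow> coprime_idl D (principal D \<alpha>) cf \<longrightarrow>
            \<phi> (principal D \<alpha>) = \<alpha> * \<psi> \<alpha>)) \<and>
     (\<forall>c'. integral_ideal D c' \<longrightarrow> idl_dvd D c' cf \<longrightarrow>
        (\<forall>\<alpha>\<in>OK D. \<alpha> \<noteq> 0 \<longrightarrow> coprime_idl D (principal D \<alpha>) cf \<longrightarrow> \<alpha> - 1 \<in> c' \<longrightarrow>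
            \<phi> (principal D \<alpha>) = \<alpha>) \<longrightarrow> c' = cf)"

definition hecke_theta :: "int \<Rightarrow> complex set \<Rightarrow> (complex set \<Rightarrow> complex) \<Rightarrow> complex \<Rightarrow> complex" where
  "hecke_theta D cf \<phi> \<tau> =
     infsum (\<lambda>I. (if coprime_idl D I cf then \<phi> I else 0) *
                  exp (2 * pi * \<i> * \<tau> * of_nat (idl_norm D I)))
            {I. integral_ideal D I}"

definition latt :: "complex \<Rightarrow> complex set" where
  "latt z = {of_int m + of_int n * z | m n. True}"

definition mult_ring :: "complex set \<Rightarrow> complex set" where
  "mult_ring L = {\<alpha>. \<forall>w\<in>L. \<alpha> * w \<in> L}"

text \<open>z_1..z_h represent the C-isomorphism classes of elliptic curves with CM by O_K.\<close>
definition CM_reps :: "int \<Rightarrow> nat \<Rightarrow> (nat \<Rightarrow> complex) \<Rightarrow> bool" where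
  "CM_reps D h z \<longleftrightarrow>
     (\<forall>a\<in>{1..h}. Im (z a) > 0 \<and> mult_ring (latt (z a)) = OK D) \<and>
     (\<forall>a\<in>{1..h}. \<forall>a'\<in>{1..h}. a \<noteq> a' \<longrightarrow>
        \<not> (\<exists>s. s \<noteq> 0 \<and> (\<lambda>w. s * w) ` latt (z a) = latt (z a'))) \<and>
     (\<forall>w. Im w > 0 \<longrightarrow> mult_ring (latt w) = OK D \<longrightarrow>
        (\<exists>a\<in>{1..h}. \<exists>s. s \<noteq> 0 \<and> (\<lambda>u. s * u) ` latt w = latt (z a)))"

definition prim_eq :: "complex \<Rightarrow> int \<Rightarrow> int \<Rightarrow> int \<Rightarrow> bool" where
  "prim_eq z A B C \<longleftrightarrow> A > 0 \<and> gcd (gcd A B) C = 1 \<and>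
     of_int A * z\<^sup>2 + of_int B * z + of_int C = 0"

text \<open>Vectors are coordinates (y1,y2) w.r.t. the basis e_2, e_1, i.e. y = y1 e_2 + y2 e_1;
  Gram matrix f * [[2A, B], [B, 2C]].\<close>
definition bil :: "nat \<Rightarrow> int \<Rightarrow> int \<Rightarrow> int \<Rightarrow> real \<times> real \<Rightarrow> real \<times> real \<Rightarrow> real" where
  "bil f A B C x y = of_nat f * (2 * of_int A * fst x * fst y
       + of_int B * (fst x * snd y + snd x * fst y) + 2 * of_int C * snd x * snd y)"

definition Lam :: "(real \<times> real) set" where
  "Lam = {(of_int m, of_int n) | m n. True}"

definition Lam_dual :: "nat \<Rightarrow> int \<Rightarrow> int \<Rightarrow> int \<Rightarrow> (real \<times> real) set" where
  "Lam_dual f A B C = {y. \<forall>x\<in>Lam. bil f A B C y x \<in> \<int>}"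

definition coset :: "real \<times> real \<Rightarrow> (real \<times> real) set" where
  "coset y = {(fst y + fst x, snd y + snd x) | x. x \<in> Lam}"

definition disc_grp :: "nat \<Rightarrow> int \<Rightarrow> int \<Rightarrow> int \<Rightarrow> (real \<times> real) set set" where
  "disc_grp f A B C = coset ` Lam_dual f A B C"

definition Omega' :: "nat \<Rightarrow> int \<Rightarrow> complex \<Rightarrow> real \<times> real \<Rightarrow> complex" where
  "Omega' f A z y = complex_of_real (sqrt (2 * of_int A * of_nat f)) *
                    (complex_of_real (fst y) - complex_of_real (snd y) * z)"

definition Omega :: "nat \<Rightarrow> int \<Rightarrow> int \<Rightarrow> int \<Rightarrow> complex \<Rightarrow> real \<times> real \<Rightarrow> complex" where
  "Omega f A B C z y = \<i> * complex_of_real (sqrt (of_nat (card (disc_grp f A B C))))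
       / complex_of_real (sqrt (2 * of_int A * of_nat f)) * Omega' f A z y"

definition f_theta :: "int \<Rightarrow> nat \<Rightarrow> int \<Rightarrow> int \<Rightarrow> int \<Rightarrow> complex \<Rightarrow> complex \<Rightarrow> (real \<times> real) set \<Rightarrow> complex" where
  "f_theta D f A B C z \<tau> \<beta> =
     infsum (\<lambda>y. Omega' f A z y *
                 exp (pi * \<i> * of_nat f * of_int \<bar>D\<bar> * \<tau> * complex_of_real (bil f A B C y y)))
            (Lam_dual f A B C \<inter> \<beta>)"

text \<open>Annihilator of Omega(beta) in b_z / c b_z (computed on a representative of beta).\<close>
definition annih :: "int \<Rightarrow> nat \<Rightarrow> int \<Rightarrow> int \<Rightarrow> int \<Rightarrow> complex \<Rightarrow> (real \<times> real) set \<Rightarrow> complex set" where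
  "annih D f A B C z \<beta> =
     {\<alpha> \<in> OK D. \<alpha> * Omega f A B C z (SOME y. y \<in> \<beta>) \<in>
                 (\<lambda>w. of_nat f * sqrtD D * w) ` latt z}"

text \<open>orb_q: those beta whose annihilator equals c q^{-1}, i.e. annihilator * q = c.\<close>
definition orb :: "int \<Rightarrow> nat \<Rightarrow> int \<Rightarrow> int \<Rightarrow> int \<Rightarrow> complex \<Rightarrow> complex set \<Rightarrow> (real \<times> real) set set" where
  "orb D f A B C z q = {\<beta> \<in> disc_grp f A B C. idl_mult (annih D f A B C z \<beta>) q = cbar D f}"

end

theory Submission
  imports Defs
begin

text \<open>Put \<open>\<gamma> = f \<surd>D\<close>, \<open>\<bb> = \<int> + \<int>z\<close> and \<open>N = A \<bb>'\<close>, where \<open>\<bb>'\<close> is the complex conjugate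
  of \<open>\<bb>\<close>; then \<open>N\<close> is the inverse of \<open>\<bb>\<close>.  The map \<open>\<Omega>\<close> identifies \<open>\<Lambda>\<close> and its dual with \<open>\<gamma>\<bb>\<close> and
  \<open>\<bb>\<close>, and \<open>f\<bar>D\<bar>(y, y) = 2 A \<bar>\<Omega>(y)\<bar>\<^sup>2\<close>.  The integral ideals in the class of \<open>N\<close> are the \<open>wN\<close> with
  \<open>w \<in> \<bb> - {0}\<close>, where \<open>w\<close> is determined up to units and \<open>wN\<close> has norm \<open>A \<bar>w\<bar>\<^sup>2\<close>.  So the Hecke
  theta function is the sum over the classes and over \<open>w \<in> \<bb>\<close> of \<open>\<phi>(wN) exp(2\<pi>i\<tau>A\<bar>w\<bar>\<^sup>2)\<close>, divided
  by the number of units.  If \<open>J\<close> is prime to the conductor and inverse to \<open>wN\<close> in the class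
  group, evaluating \<open>\<phi>\<close> on the principal ideals \<open>wNJ\<close> and \<open>w'NJ\<close> shows that \<open>\<phi>(wN) / w\<close> depends
  only on \<open>w\<close> modulo \<open>\<gamma>\<bb>\<close>; this quotient is the coefficient.  It vanishes unless \<open>wN\<close> is prime to
  the conductor, and then \<open>\<qq> = wN + \<gamma>\<O>\<close> is the required divisor: the annihilator of \<open>w\<close> in
  \<open>\<bb> / \<gamma>\<bb>\<close> is \<open>\<gamma>\<qq>\<^sup>-\<^sup>1\<close>.\<close>

section \<open>Products of additive subgroups of the complex numbers\<close>

definition smul :: "complex \<Rightarrow> complex set \<Rightarrow> complex set" where
  "smul s M = (\<lambda>x. s * x) ` M"

text \<open>The closure condition is the one over which \<open>idl_mult\<close> quantifies, so that
  \<open>idl_mult I J\<close> is the least additive subgroup containing all products.\<close>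

definition add_subgroup :: "complex set \<Rightarrow> bool" where
  "add_subgroup M \<longleftrightarrow> 0 \<in> M \<and> (\<forall>u\<in>M. \<forall>v\<in>M. u + v \<in> M \<and> - u \<in> M)"

lemma add_subgroupI:
  assumes "0 \<in> M" "\<And>u v. u \<in> M \<Longrightarrow> v \<in> M \<Longrightarrow> u + v \<in> M" "\<And>u. u \<in> M \<Longrightarrow> - u \<in> M"
  shows "add_subgroup M"
  using assms by (auto simp: add_subgroup_def)

lemma add_subgroupD:
  assumes "add_subgroup M"
  shows "0 \<in> M" "u \<in> M \<Longrightarrow> v \<in> M \<Longrightarrow> u + v \<in> M" "u \<in> M \<Longrightarrow> - u \<in> M"
    "u \<in> M \<Longrightarrow> v \<in> M \<Longrightarrow> u - v \<in> M"
proof -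
  have *: "u \<in> M \<Longrightarrow> v \<in> M \<Longrightarrow> u + v \<in> M" "u \<in> M \<Longrightarrow> - u \<in> M" for u v
    using assms by (auto simp: add_subgroup_def)
  show "0 \<in> M" "u \<in> M \<Longrightarrow> v \<in> M \<Longrightarrow> u + v \<in> M" "u \<in> M \<Longrightarrow> - u \<in> M"
    using assms by (auto simp: add_subgroup_def)
  show "u \<in> M \<Longrightarrow> v \<in> M \<Longrightarrow> u - v \<in> M" using *(1)[of u "- v"] *(2)[of v] by simp
qed

lemma add_subgroup_of_int_mult:
  assumes "add_subgroup M" "u \<in> M"
  shows "of_int k * u \<in> M"
proof -
  have nat: "of_nat n * u \<in> M" for n
    by (induction n) (use assms in \<open>auto simp: algebra_simps intro: add_subgroupD\<close>)
  show ?thesis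
  proof (cases k)
    case (nonneg n) thus ?thesis using nat[of n] by simp
  next
    case (neg n)
    have "of_int k * u = - (of_nat (Suc n) * u)" unfolding neg by (simp add: algebra_simps)
    thus ?thesis using nat[of "Suc n"] add_subgroupD(3)[OF assms(1)] by metis
  qed
qed

lemma smul_smul: "smul s (smul t M) = smul (s * t) M"
  by (auto simp: smul_def image_image mult.assoc)

lemma smul_one [simp]: "smul 1 M = M"
  by (simp add: smul_def)

lemma smul_memI: "x \<in> M \<Longrightarrow> s * x \<in> smul s M"
  by (auto simp: smul_def)

lemma smul_mem_iff: "s \<noteq> 0 \<Longrightarrow> s * x \<in> smul s M \<longleftrightarrow> x \<in> M"
  by (auto simp: smul_def)

lemma smul_eq_iff: "s \<noteq> 0 \<Longrightarrow> smul s M = N \<longleftrightarrow> M = smul (inverse s) N"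
  by (auto simp: smul_smul)

lemma add_subgroup_smul: "add_subgroup M \<Longrightarrow> add_subgroup (smul s M)"
proof (rule add_subgroupI)
  assume M: "add_subgroup M"
  show "0 \<in> smul s M" using smul_memI[OF add_subgroupD(1)[OF M], of s] by simp
  fix u assume "u \<in> smul s M"
  then obtain x where x: "u = s * x" "x \<in> M" by (auto simp: smul_def)
  show "- u \<in> smul s M" using smul_memI[OF add_subgroupD(3)[OF M x(2)], of s] x by simp
  fix v assume "v \<in> smul s M"
  then obtain y where y: "v = s * y" "y \<in> M" by (auto simp: smul_def)
  show "u + v \<in> smul s M"
    using smul_memI[OF add_subgroupD(2)[OF M x(2) y(2)], of s] x y by (simp add: distrib_left)
qed

lemma idl_mult_mem: "u \<in> I \<Longrightarrow> v \<in> J \<Longrightarrow> u * v \<in> idl_mult I J"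
  by (auto simp: idl_mult_def)

text \<open>Minimality of the product. Inclusions between products are proved with it; where a
  factor is fixed, \<open>M\<close> is the preimage of the target under multiplication by that
  factor.\<close>

lemma idl_mult_least:
  assumes "add_subgroup M" "\<And>u v. u \<in> I \<Longrightarrow> v \<in> J \<Longrightarrow> u * v \<in> M"
  shows "idl_mult I J \<subseteq> M"
proof
  fix x assume "x \<in> idl_mult I J"
  thus "x \<in> M" using assms unfolding idl_mult_def add_subgroup_def by blast
qed

lemma add_subgroup_idl_mult: "add_subgroup (idl_mult I J)"
  unfolding idl_mult_def by (rule add_subgroupI) auto

lemma idl_mult_comm: "idl_mult I J = idl_mult J I"
proof -
  have "idl_mult I J \<subseteq> idl_mult J I" for I J
    by (rule idl_mult_least[OF add_subgroup_idl_mult]) (subst mult.commute, rule idl_mult_mem)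
  thus ?thesis by blast
qed

lemma idl_mult_mono: "I \<subseteq> I' \<Longrightarrow> J \<subseteq> J' \<Longrightarrow> idl_mult I J \<subseteq> idl_mult I' J'"
  by (intro idl_mult_least add_subgroup_idl_mult) (auto intro: idl_mult_mem)

text \<open>For fixed \<open>v\<close> the numbers \<open>u\<close> with \<open>u * v\<close> in the
  right-hand side form an additive subgroup that contains all \<open>x * y\<close>, so minimality of
  the inner product applies.\<close>

lemma idl_mult_assoc_subset: "idl_mult (idl_mult I J) L \<subseteq> idl_mult I (idl_mult J L)"
proof (rule idl_mult_least[OF add_subgroup_idl_mult])
  fix u v assume u: "u \<in> idl_mult I J" and v: "v \<in> L"
  have "idl_mult I J \<subseteq> {u. u * v \<in> idl_mult I (idl_mult J L)}"
  proof (rule idl_mult_least)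
    show "add_subgroup {u. u * v \<in> idl_mult I (idl_mult J L)}"
      by (rule add_subgroupI)
         (auto simp: distrib_right intro: add_subgroupD[OF add_subgroup_idl_mult])
  next
    fix x y assume "x \<in> I" "y \<in> J"
    thus "x * y \<in> {u. u * v \<in> idl_mult I (idl_mult J L)}"
      using v by (auto simp: mult.assoc intro!: idl_mult_mem)
  qed
  thus "u * v \<in> idl_mult I (idl_mult J L)" using u by auto
qed

lemma idl_mult_assoc: "idl_mult (idl_mult I J) L = idl_mult I (idl_mult J L)"
  \<comment> \<open>The second instance becomes the reverse inclusion after all factors are
    commuted.\<close>
  using idl_mult_assoc_subset[of I J L] idl_mult_assoc_subset[of L J I]
  by (metis idl_mult_comm subset_antisym)

lemma idl_mult_smul_left: "idl_mult (smul s I) J = smul s (idl_mult I J)"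
proof
  show "idl_mult (smul s I) J \<subseteq> smul s (idl_mult I J)"
    by (rule idl_mult_least[OF add_subgroup_smul[OF add_subgroup_idl_mult]])
       (auto simp: smul_def image_iff mult.assoc intro!: bexI[OF _ idl_mult_mem])
  have "idl_mult I J \<subseteq> {x. s * x \<in> idl_mult (smul s I) J}"
  proof (rule idl_mult_least)
    show "add_subgroup {x. s * x \<in> idl_mult (smul s I) J}"
      by (rule add_subgroupI)
         (auto simp: distrib_left intro: add_subgroupD[OF add_subgroup_idl_mult])
  next
    fix u v assume "u \<in> I" "v \<in> J"
    thus "u * v \<in> {x. s * x \<in> idl_mult (smul s I) J}"
      by (auto simp flip: mult.assoc intro!: idl_mult_mem smul_memI)
  qed
  thus "smul s (idl_mult I J) \<subseteq> idl_mult (smul s I) J"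
    by (auto simp: smul_def)
qed

lemma idl_mult_smul_right: "idl_mult I (smul s J) = smul s (idl_mult I J)"
  by (metis idl_mult_comm idl_mult_smul_left)

section \<open>Lattices and quadratic irrationalities\<close>

lemma latt_iff: "x \<in> latt z \<longleftrightarrow> (\<exists>m n. x = of_int m + of_int n * z)"
  by (auto simp: latt_def)

lemma lattE:
  assumes "x \<in> latt z"
  obtains m n where "x = of_int m + of_int n * z"
  using assms by (auto simp: latt_iff)

lemma latt_memI: "of_int m + of_int n * z \<in> latt z"
  by (auto simp: latt_def)

lemma add_subgroup_latt: "add_subgroup (latt z)"
proof (rule add_subgroupI)
  show "0 \<in> latt z" using latt_memI[of 0 0] by simp
next
  fix u v assume "u \<in> latt z" "v \<in> latt z"
  then obtain m n m' n' where "u = of_int m + of_int n * z" "v = of_int m' + of_int n' * z"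
    by (auto simp: latt_iff)
  hence "u + v = of_int (m + m') + of_int (n + n') * z" by (simp add: algebra_simps)
  thus "u + v \<in> latt z" using latt_memI by metis
next
  fix u assume "u \<in> latt z"
  then obtain m n where "u = of_int m + of_int n * z"
    by (auto simp: latt_iff)
  hence "- u = of_int (- m) + of_int (- n) * z" by (simp add: algebra_simps)
  thus "- u \<in> latt z" using latt_memI by metis
qed

lemma one_mem_latt: "1 \<in> latt z" using latt_memI[of 1 0] by simp
lemma self_mem_latt: "z \<in> latt z" using latt_memI[of 0 1] by simp

lemma latt_subset:
  assumes "add_subgroup M" "1 \<in> M" "z \<in> M"
  shows "latt z \<subseteq> M"
proof
  fix x assume "x \<in> latt z"
  then obtain m n where "x = of_int m * 1 + of_int n * z" by (auto simp: latt_iff)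
  thus "x \<in> M"
    using add_subgroupD(2)[OF assms(1)] add_subgroup_of_int_mult[OF assms(1)] assms by blast
qed

lemma latt_coord_unique:
  assumes "Im z \<noteq> 0"
    and "complex_of_int m + of_int n * z = of_int m' + of_int n' * z"
  shows "m = m' \<and> n = n'"
proof -
  have "Im (complex_of_int m + of_int n * z) = Im (of_int m' + of_int n' * z)"
    using assms by simp
  hence "real_of_int n * Im z = of_int n' * Im z" by simp
  hence "n = n'" using assms by simp
  with assms show ?thesis by simp
qed

section \<open>Primitive quadratic equations and multiplier rings\<close>

lemma prim_eq_bezout:
  assumes "prim_eq z A B C"
  obtains p q r where "p * A + q * B + r * C = 1"
proof -
  obtain u v where uv: "u * gcd A B + v * C = gcd (gcd A B) C"
    using bezout_int by blast
  obtain s t where st: "s * A + t * B = gcd A B" using bezout_int by blast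
  have "u * (s * A + t * B) + v * C = 1"
    using uv st assms by (simp add: prim_eq_def)
  hence "(u * s) * A + (u * t) * B + v * C = 1" by (simp add: algebra_simps)
  thus ?thesis using that by blast
qed

text \<open>If \<open>x = p + q z\<close> maps \<open>z\<close> into the lattice, comparing
  coefficients shows that \<open>A\<close> divides \<open>q B\<close> and \<open>q C\<close>; as
  \<open>A\<close>, \<open>B\<close>, \<open>C\<close> are coprime, \<open>A\<close> divides
  \<open>q\<close>. Conversely, the equation of \<open>z\<close> shows that \<open>A z\<close> maps
  the lattice into itself.\<close>

lemma mult_ring_latt:
  assumes "Im z > 0" "prim_eq z A B C"
  shows "mult_ring (latt z) = latt (of_int A * z)"
proof
  have eq: "of_int A * z\<^sup>2 + of_int B * z + of_int C = 0" and A: "A > 0"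
    using assms by (auto simp: prim_eq_def)
  show "latt (of_int A * z) \<subseteq> mult_ring (latt z)"
  proof (rule latt_subset)
    show "add_subgroup (mult_ring (latt z))"
      unfolding mult_ring_def
      by (rule add_subgroupI)
         (auto simp: distrib_right intro: add_subgroupD[OF add_subgroup_latt])
    show "1 \<in> mult_ring (latt z)" by (simp add: mult_ring_def)
    show "of_int A * z \<in> mult_ring (latt z)"
      unfolding mult_ring_def
    proof safe
      fix w assume "w \<in> latt z"
      then obtain m n where w: "w = of_int m + of_int n * z" by (auto simp: latt_iff)
      have "of_int A * z * w = of_int m * of_int A * z + of_int n * (of_int A * z\<^sup>2)"
        by (simp add: w algebra_simps power2_eq_square)
      also have "of_int A * z\<^sup>2 = - (of_int B * z) - of_int C"
        using eq by (simp add: algebra_simps eq_neg_iff_add_eq_0)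
      also have "of_int m * of_int A * z + of_int n * (- (of_int B * z) - of_int C) =
          of_int (- n * C) + of_int (m * A - n * B) * z" by (simp add: algebra_simps)
      finally show "of_int A * z * w \<in> latt z" using latt_memI by metis
    qed
  qed
  show "mult_ring (latt z) \<subseteq> latt (of_int A * z)"
  proof
    fix x assume x: "x \<in> mult_ring (latt z)"
    hence "x * 1 \<in> latt z" "x * z \<in> latt z"
      using one_mem_latt self_mem_latt unfolding mult_ring_def by blast+
    then obtain p q r s where pq: "x = of_int p + of_int q * z"
      and rs: "x * z = of_int r + of_int s * z" by (auto simp: latt_iff)
    have "of_int A * (x * z) = of_int A * of_int p * z + of_int q * (of_int A * z\<^sup>2)"
      by (simp add: pq algebra_simps power2_eq_square)
    also have "of_int A * z\<^sup>2 = - (of_int B * z) - of_int C"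
      using eq by (simp add: algebra_simps eq_neg_iff_add_eq_0)
    finally have "of_int (- q * C) + of_int (A * p - q * B) * z = of_int (A * r) + of_int (A * s) * z"
      by (simp add: rs algebra_simps)
    from latt_coord_unique[OF _ this] assms(1)
    have 1: "- q * C = A * r" "A * p - q * B = A * s" by auto
    obtain a b c where abc: "a * A + b * B + c * C = 1" using prim_eq_bezout assms by blast
    have "q * B = A * (p - s)" "q * C = A * (- r)" using 1 by (auto simp: algebra_simps)
    have "q = q * (a * A + b * B + c * C)" using abc by simp
    also have "\<dots> = A * (q * a) + b * (q * B) + c * (q * C)" by (simp add: algebra_simps)
    also have "\<dots> = A * (q * a + b * (p - s) + c * (- r))"
      unfolding \<open>q * B = _\<close> \<open>q * C = _\<close> by (simp add: algebra_simps)
    finally obtain k where "q = A * k" by blast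
    hence "x = of_int p + of_int k * (of_int A * z)" by (simp add: pq)
    thus "x \<in> latt (of_int A * z)" using latt_memI by metis
  qed
qed

text \<open>The square of \<open>2 A z + B\<close> is the discriminant, and its imaginary part is
  positive, which singles out the root in the upper half plane.\<close>

lemma prim_eq_root:
  assumes "Im z > 0" "prim_eq z A B C"
  shows "B\<^sup>2 - 4 * A * C < 0" "2 * of_int A * z + of_int B = sqrtD (B\<^sup>2 - 4 * A * C)"
proof -
  define v where "v = 2 * of_int A * z + of_int B"
  have A: "A > 0" and eq: "of_int A * z\<^sup>2 + of_int B * z + of_int C = 0"
    using assms by (auto simp: prim_eq_def)
  have "v\<^sup>2 = 4 * of_int A * (of_int A * z\<^sup>2 + of_int B * z + of_int C) + of_int (B\<^sup>2 - 4 * A * C)"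
    by (simp add: v_def power2_eq_square algebra_simps)
  hence v2: "v\<^sup>2 = of_int (B\<^sup>2 - 4 * A * C)" unfolding eq by simp
  have Imv: "Im v > 0" using A assms(1) by (simp add: v_def)
  have "Im (v\<^sup>2) = 0" "Re (v\<^sup>2) = of_int (B\<^sup>2 - 4 * A * C)" unfolding v2 by simp_all
  hence "Re v = 0" and re: "- (Im v)\<^sup>2 = of_int (B\<^sup>2 - 4 * A * C)"
    using Imv by (auto simp: power2_eq_square)
  have "real_of_int (B\<^sup>2 - 4 * A * C) < 0" unfolding re[symmetric] using Imv by simp
  thus "B\<^sup>2 - 4 * A * C < 0" by (simp only: of_int_less_0_iff)
  have "real_of_int (- (B\<^sup>2 - 4 * A * C)) = (Im v)\<^sup>2" using re by simp
  hence "sqrt (real_of_int (- (B\<^sup>2 - 4 * A * C))) = Im v" using Imv by simp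
  thus "v = sqrtD (B\<^sup>2 - 4 * A * C)" unfolding sqrtD_def
    using \<open>Re v = 0\<close> by (simp add: complex_eq_iff)
qed

section \<open>The maximal order and fundamental discriminants\<close>

definition om :: "int \<Rightarrow> complex" where "om D = (of_int D + sqrtD D) / 2"

lemma OK_eq_latt: "OK D = latt (om D)"
  by (simp add: OK_def latt_def om_def)

lemma fund_disc_neg: "fund_disc D \<Longrightarrow> D < 0"
  by (simp add: fund_disc_def)

lemma sqrtD_square: "D < 0 \<Longrightarrow> sqrtD D * sqrtD D = of_int D"
  by (simp add: sqrtD_def algebra_simps flip: of_real_mult)

lemma sqrtD_nonzero: "D < 0 \<Longrightarrow> sqrtD D \<noteq> 0"
  using sqrtD_square[of D] by auto

lemma Im_om: "D < 0 \<Longrightarrow> Im (om D) = sqrt (of_int (- D)) / 2"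
  by (simp add: om_def sqrtD_def)

lemma Im_om_pos: "D < 0 \<Longrightarrow> Im (om D) > 0"
  by (simp add: Im_om)

lemma fund_disc_mod4: "fund_disc D \<Longrightarrow> D mod 4 = 0 \<or> D mod 4 = 1"
  by (auto simp: fund_disc_def)

text \<open>\<open>E = B^2 - 4 A C\<close> is 0 or 1 modulo 4. Squarefreeness leaves only
  \<open>q^2 = 1\<close>, except for \<open>D = 4 m\<close> and \<open>q = 2 r\<close> with
  \<open>r^2 = 1\<close>; then \<open>m = E\<close>, which is impossible because \<open>m\<close> is
  2 or 3 modulo 4.\<close>

lemma fund_disc_square_factor:
  assumes "fund_disc D" "D = q\<^sup>2 * (B\<^sup>2 - 4 * A * C)"
  shows "B\<^sup>2 - 4 * A * C = D"
proof -
  define E where "E = B\<^sup>2 - 4 * A * C"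
  have E4: "E mod 4 = 0 \<or> E mod 4 = 1"
  proof (cases "even B")
    case True
    then obtain k where "B = 2 * k" by blast
    hence "E = 4 * (k\<^sup>2 - A * C)" by (simp add: E_def power2_eq_square algebra_simps)
    thus ?thesis by simp
  next
    case False
    then obtain k where "B = 2 * k + 1" by (blast elim: oddE)
    hence "E = 1 + 4 * (k\<^sup>2 + k - A * C)" by (simp add: E_def power2_eq_square algebra_simps)
    thus ?thesis by (simp only: mod_mult_self2) simp
  qed
  have DE: "D = q\<^sup>2 * E" using assms by (simp add: E_def)
  have sq1: "x\<^sup>2 = 1" if "squarefree y" "x\<^sup>2 dvd y" for x y :: int
  proof -
    have "\<bar>x\<bar> = 1" using squarefreeD[OF that] by simp
    thus ?thesis by (metis power2_abs one_power2)
  qed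
  from assms(1) consider "squarefree D"
    | m where "D = 4 * m" "m mod 4 = 2 \<or> m mod 4 = 3" "squarefree m"
    by (auto simp: fund_disc_def)
  hence "E = D"
  proof cases
    case 1
    hence "q\<^sup>2 = 1" by (rule sq1) (rule dvdI[OF DE])
    thus ?thesis using DE by simp
  next
    case (2 m)
    show ?thesis
    proof (cases "even q")
      case True
      then obtain r where "q = 2 * r" by blast
      hence m: "m = r\<^sup>2 * E" using DE 2(1) by (simp add: power2_eq_square)
      have "r\<^sup>2 = 1" using 2(3) by (rule sq1) (rule dvdI[OF m])
      hence "m = E" using m by simp
      thus ?thesis using 2(2) E4 by auto
    next
      case False
      have "coprime (q\<^sup>2) (4 :: int)"
        using False coprime_power_right_iff[of "q\<^sup>2" 2 2] by simp
      moreover have "q\<^sup>2 dvd 4 * m" unfolding 2(1)[symmetric] by (rule dvdI[OF DE])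
      ultimately have "q\<^sup>2 dvd m" using coprime_dvd_mult_right_iff by blast
      hence "q\<^sup>2 = 1" using 2(3) sq1 by blast
      thus ?thesis using DE by simp
    qed
  qed
  thus ?thesis by (simp add: E_def)
qed

text \<open>The discriminant condition encodes complex multiplication by the full maximal order: for
  fundamental \<open>D\<close> it amounts to \<open>mult_ring (latt z) = OK D\<close>, by
  \<open>cm_pointI\<close> and \<open>cm_point_mult_ring\<close>.\<close>

definition cm_point :: "int \<Rightarrow> complex \<Rightarrow> int \<Rightarrow> int \<Rightarrow> int \<Rightarrow> bool" where
  "cm_point D z A B C \<longleftrightarrow> Im z > 0 \<and> prim_eq z A B C \<and> B\<^sup>2 - 4 * A * C = D"

lemma cm_pointD:
  assumes "cm_point D z A B C"
  shows "Im z > 0" "prim_eq z A B C" "A > 0" "D < 0" "B\<^sup>2 - 4 * A * C = D"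
    "of_int A * z = (- of_int B + sqrtD D) / 2"
    "of_int A * z\<^sup>2 + of_int B * z + of_int C = 0"
proof -
  show z: "Im z > 0" "prim_eq z A B C" and D: "B\<^sup>2 - 4 * A * C = D"
    using assms by (auto simp: cm_point_def)
  show "A > 0" "of_int A * z\<^sup>2 + of_int B * z + of_int C = 0"
    using z by (auto simp: prim_eq_def)
  show "D < 0" using prim_eq_root(1)[OF z] D by simp
  have "2 * (of_int A * z) = - of_int B + sqrtD D"
    using prim_eq_root(2)[OF z] unfolding D by (simp add: algebra_simps)
  thus "of_int A * z = (- of_int B + sqrtD D) / 2" by (simp add: algebra_simps)
qed

lemma cm_point_Im: "cm_point D z A B C \<Longrightarrow> Im z = Im (om D) / of_int A"
proof -
  assume c: "cm_point D z A B C"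
  have "Im (of_int A * z) = Im (om D)" unfolding cm_pointD(6)[OF c] om_def by simp
  thus ?thesis using cm_pointD(3)[OF c] by (simp add: field_simps)
qed

text \<open>\<open>om D\<close> lies in the order generated by \<open>A z\<close>, so comparing
  imaginary parts gives \<open>D = q^2 E\<close> with \<open>E\<close> the discriminant of the
  equation; as \<open>D\<close> is fundamental, \<open>E = D\<close>.\<close>

lemma cm_pointI:
  assumes "fund_disc D" "Im z > 0" "prim_eq z A B C" "OK D \<subseteq> mult_ring (latt z)"
  shows "cm_point D z A B C"
proof -
  define E where "E = B\<^sup>2 - 4 * A * C"
  note root = prim_eq_root[OF assms(2,3), folded E_def]
  have A: "A > 0" using assms by (auto simp: prim_eq_def)
  have D: "D < 0" using assms fund_disc_neg by auto
  have "om D \<in> latt (of_int A * z)"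
    using assms mult_ring_latt self_mem_latt OK_eq_latt by blast
  then obtain p q where pq: "om D = of_int p + of_int q * (of_int A * z)" by (auto simp: latt_iff)
  have "Im (2 * of_int A * z + of_int B) = sqrt (of_int (- E))"
    unfolding root(2) by (simp add: sqrtD_def)
  hence "2 * (of_int A * Im z) = sqrt (of_int (- E))" by simp
  moreover have "Im (om D) = of_int q * (of_int A * Im z)" using pq by simp
  ultimately have "sqrt (of_int (- D)) = of_int q * sqrt (of_int (- E))"
    using D by (simp add: Im_om)
  hence "(sqrt (of_int (- D)))\<^sup>2 = (of_int q)\<^sup>2 * (sqrt (of_int (- E)))\<^sup>2"
    by (simp only: power_mult_distrib)
  hence "real_of_int (- D) = of_int (q\<^sup>2 * (- E))" using D root(1) by simp
  hence "- D = q\<^sup>2 * (- E)" by (simp only: of_int_eq_iff)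
  hence "D = q\<^sup>2 * E" by simp
  hence "E = D" using fund_disc_square_factor assms(1) unfolding E_def by blast
  thus ?thesis using assms by (simp add: cm_point_def E_def)
qed

lemma latt_shift: "latt (of_int k + z) = latt z"
proof -
  have *: "latt (of_int k + z) \<subseteq> latt z" for k z
    by (rule latt_subset[OF add_subgroup_latt one_mem_latt]) (use latt_memI[of k 1 z] in simp)
  from this[of k z] this[of "-k" "of_int k + z"] show ?thesis by simp
qed

text \<open>\<open>B\<close> and \<open>D\<close> have the same parity, so \<open>om D\<close> and
  \<open>A z\<close> differ by an integer and span the same lattice together with 1.\<close>

lemma cm_point_mult_ring:
  assumes "cm_point D z A B C"
  shows "mult_ring (latt z) = OK D"
proof -
  note c = cm_pointD[OF assms]
  have "B\<^sup>2 - D = 2 * (2 * A * C)" using c(5) by simp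
  hence "even (B\<^sup>2 - D)" by (simp only: dvd_triv_left)
  hence "even (B + D)" by simp
  then obtain k where k: "B + D = 2 * k" by blast
  hence "complex_of_int (B + D) = of_int (2 * k)" by (simp only: )
  hence "complex_of_int B + of_int D = 2 * of_int k" by simp
  hence k': "of_int k = (complex_of_int B + of_int D) / 2" by simp
  have "om D = of_int k + of_int A * z"
    unfolding om_def c(6) k' by (simp add: field_simps)
  thus ?thesis by (simp add: mult_ring_latt[OF c(1,2)] latt_shift OK_eq_latt)
qed

text \<open>Makes \<open>OK D\<close> itself the lattice of a CM point, so that results on these
  lattices apply to the ring. The constant coefficient is integral because \<open>D\<close> is 0 or
  1 modulo 4.\<close>

lemma cm_point_om:
  assumes "fund_disc D"
  shows "cm_point D (om D) 1 (- D) ((D\<^sup>2 - D) div 4)"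
proof -
  have D: "D < 0" using fund_disc_neg assms by auto
  obtain l where l: "D\<^sup>2 - D = 4 * l"
  proof -
    have "D mod 4 = 0 \<or> D mod 4 = 1" using fund_disc_mod4 assms by auto
    moreover have "D = 4 * (D div 4) + D mod 4" by simp
    ultimately obtain k where "D = 4 * k \<or> D = 4 * k + 1"
      by (metis (no_types) add.right_neutral)
    hence "\<exists>l. D\<^sup>2 - D = 4 * l"
    proof
      assume "D = 4 * k"
      hence "D\<^sup>2 - D = 4 * (4 * k\<^sup>2 - k)" by (simp add: power2_eq_square algebra_simps)
      thus ?thesis by blast
    next
      assume "D = 4 * k + 1"
      hence "D\<^sup>2 - D = 4 * (4 * k\<^sup>2 + k)" by (simp add: power2_eq_square algebra_simps)
      thus ?thesis by blast
    qed
    thus ?thesis using that by blast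
  qed
  have "complex_of_int (4 * l) = of_int (D\<^sup>2 - D)" by (simp only: l)
  hence "4 * complex_of_int l = of_int D * of_int D - of_int D"
    by (simp add: power2_eq_square)
  moreover have "4 * ((om D)\<^sup>2 - of_int D * om D + of_int l) =
      sqrtD D * sqrtD D - of_int D * of_int D + 4 * of_int l"
    by (simp add: om_def power2_eq_square field_simps)
  ultimately have "4 * ((om D)\<^sup>2 - of_int D * om D + of_int l) = 0"
    by (simp add: sqrtD_square[OF D])
  hence "(om D)\<^sup>2 - of_int D * om D + of_int l = 0" by (simp only: mult_eq_0_iff) simp
  thus ?thesis using Im_om_pos[OF D] l
    by (auto simp: cm_point_def prim_eq_def power2_eq_square)
qed

lemma OK_ring:
  assumes "fund_disc D"
  shows "1 \<in> OK D" "x \<in> OK D \<Longrightarrow> y \<in> OK D \<Longrightarrow> x * y \<in> OK D" "add_subgroup (OK D)"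
proof -
  have "mult_ring (OK D) = OK D"
    using cm_point_mult_ring[OF cm_point_om[OF assms]] by (simp add: OK_eq_latt)
  thus "x \<in> OK D \<Longrightarrow> y \<in> OK D \<Longrightarrow> x * y \<in> OK D" by (auto simp: mult_ring_def)
qed (auto simp: OK_eq_latt one_mem_latt add_subgroup_latt)

section \<open>Modules over the maximal order\<close>

text \<open>One notion for integral ideals, for the lattices \<open>latt z\<close> and for their
  inverses, which need not lie in \<open>OK D\<close>.\<close>

definition OK_module :: "int \<Rightarrow> complex set \<Rightarrow> bool" where
  "OK_module D M \<longleftrightarrow> add_subgroup M \<and> (\<forall>r\<in>OK D. \<forall>x\<in>M. r * x \<in> M)"

lemma OK_moduleD:
  assumes "OK_module D M"
  shows "add_subgroup M" "r \<in> OK D \<Longrightarrow> x \<in> M \<Longrightarrow> r * x \<in> M"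
  using assms by (auto simp: OK_module_def)

lemma of_int_mem_OK: "of_int k \<in> OK D"
  unfolding OK_eq_latt using latt_memI[of k 0 "om D"] by simp

text \<open>Negatives, absent from the definition of an ideal, come from multiplication by
  -1.\<close>

lemma integral_ideal_iff:
  "integral_ideal D I \<longleftrightarrow> OK_module D I \<and> I \<subseteq> OK D \<and> I \<noteq> {0}"
proof
  assume I: "integral_ideal D I"
  have "- x \<in> I" if "x \<in> I" for x
  proof -
    have "of_int (- 1) * x \<in> I" using I that of_int_mem_OK unfolding integral_ideal_def by blast
    thus ?thesis by simp
  qed
  thus "OK_module D I \<and> I \<subseteq> OK D \<and> I \<noteq> {0}"
    using I by (auto simp: integral_ideal_def OK_module_def add_subgroup_def)
next
  assume "OK_module D I \<and> I \<subseteq> OK D \<and> I \<noteq> {0}"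
  thus "integral_ideal D I"
    by (auto simp: integral_ideal_def OK_module_def add_subgroup_def)
qed

lemma principal_eq_smul: "principal D x = smul x (OK D)"
  by (auto simp: principal_def smul_def)

lemma cbar_eq_smul: "cbar D f = smul (of_nat f * sqrtD D) (OK D)"
  by (simp add: cbar_def principal_eq_smul)

lemma OK_module_OK: "fund_disc D \<Longrightarrow> OK_module D (OK D)"
  using OK_ring by (auto simp: OK_module_def)

lemma OK_module_smul: "OK_module D M \<Longrightarrow> OK_module D (smul s M)"
  unfolding OK_module_def
proof (intro conjI ballI)
  assume M: "add_subgroup M \<and> (\<forall>r\<in>OK D. \<forall>x\<in>M. r * x \<in> M)"
  thus "add_subgroup (smul s M)" using add_subgroup_smul by blast
  fix r x assume "r \<in> OK D" "x \<in> smul s M"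
  then obtain y where "y \<in> M" "x = s * y" by (auto simp: smul_def)
  thus "r * x \<in> smul s M" using M \<open>r \<in> OK D\<close> smul_memI[of "r * y" M s] by (simp add: mult_ac)
qed

lemma OK_module_idl_mult:
  assumes "OK_module D I"
  shows "OK_module D (idl_mult I J)"
  unfolding OK_module_def
proof (intro conjI ballI add_subgroup_idl_mult)
  fix r x assume r: "r \<in> OK D" and x: "x \<in> idl_mult I J"
  have "idl_mult I J \<subseteq> {x. r * x \<in> idl_mult I J}"
  proof (rule idl_mult_least)
    show "add_subgroup {x. r * x \<in> idl_mult I J}"
      by (rule add_subgroupI)
         (auto simp: distrib_left intro: add_subgroupD[OF add_subgroup_idl_mult])
    show "u * v \<in> {x. r * x \<in> idl_mult I J}" if "u \<in> I" "v \<in> J" for u v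
      using that OK_moduleD(2)[OF assms r] by (auto simp flip: mult.assoc intro: idl_mult_mem)
  qed
  thus "r * x \<in> idl_mult I J" using x by auto
qed

lemma idl_mult_OK_left:
  assumes "OK_module D M"
  shows "idl_mult (OK D) M = M"
proof
  show "idl_mult (OK D) M \<subseteq> M"
    using OK_moduleD[OF assms] by (intro idl_mult_least) auto
  show "M \<subseteq> idl_mult (OK D) M"
  proof
    fix x assume "x \<in> M"
    hence "of_int 1 * x \<in> idl_mult (OK D) M" using of_int_mem_OK by (intro idl_mult_mem)
    thus "x \<in> idl_mult (OK D) M" by simp
  qed
qed

lemma idl_mult_OK_right: "OK_module D M \<Longrightarrow> idl_mult M (OK D) = M"
  by (metis idl_mult_OK_left idl_mult_comm)

lemma OK_module_latt:
  assumes "cm_point D z A B C"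
  shows "OK_module D (latt z)"
  unfolding OK_module_def cm_point_mult_ring[OF assms, symmetric] mult_ring_def
  using add_subgroup_latt by auto

section \<open>Complex conjugation and the inverse of a lattice\<close>

lemma cnj_sqrtD: "cnj (sqrtD D) = - sqrtD D"
  by (simp add: sqrtD_def)

lemma cnj_om: "cnj (om D) = of_int D - om D"
  by (simp add: om_def cnj_sqrtD field_simps)

lemma cnj_mem_OK: "x \<in> OK D \<Longrightarrow> cnj x \<in> OK D"
proof -
  assume "x \<in> OK D"
  then obtain m n where "x = of_int m + of_int n * om D" by (auto simp: OK_eq_latt latt_iff)
  hence "cnj x = of_int (m + n * D) + of_int (- n) * om D"
    by (simp add: cnj_om algebra_simps)
  thus ?thesis unfolding OK_eq_latt using latt_memI by metis
qed

lemma cnj_image_cnj_image [simp]: "cnj ` cnj ` M = M"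
  by (simp add: image_image)

lemma cnj_image_smul: "cnj ` smul s M = smul (cnj s) (cnj ` M)"
  by (auto simp: smul_def image_image)

lemma add_subgroup_cnj: "add_subgroup M \<Longrightarrow> add_subgroup (cnj ` M)"
proof (rule add_subgroupI)
  assume M: "add_subgroup M"
  show "0 \<in> cnj ` M" using imageI[OF add_subgroupD(1)[OF M], of cnj] by simp
  fix u assume "u \<in> cnj ` M"
  then obtain x where x: "u = cnj x" "x \<in> M" by auto
  show "- u \<in> cnj ` M" using imageI[OF add_subgroupD(3)[OF M x(2)], of cnj] x by simp
  fix v assume "v \<in> cnj ` M"
  then obtain y where y: "v = cnj y" "y \<in> M" by auto
  show "u + v \<in> cnj ` M" using imageI[OF add_subgroupD(2)[OF M x(2) y(2)], of cnj] x y by simp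
qed

lemma OK_module_cnj:
  assumes "OK_module D M"
  shows "OK_module D (cnj ` M)"
  unfolding OK_module_def
proof (intro conjI ballI add_subgroup_cnj OK_moduleD(1)[OF assms])
  fix r x assume "r \<in> OK D" "x \<in> cnj ` M"
  then obtain y where "x = cnj y" "y \<in> M" by auto
  hence "r * x = cnj (cnj r * y)" "cnj r * y \<in> M"
    using OK_moduleD(2)[OF assms cnj_mem_OK[OF \<open>r \<in> OK D\<close>]] by auto
  thus "r * x \<in> cnj ` M" by blast
qed

lemma integral_ideal_cnj:
  assumes "integral_ideal D I"
  shows "integral_ideal D (cnj ` I)"
proof -
  have "cnj ` I \<noteq> {0}"
  proof
    assume "cnj ` I = {0}"
    hence "cnj ` cnj ` I = cnj ` {0}" by simp
    hence "I = {0}" unfolding cnj_image_cnj_image by simp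
    thus False using assms by (simp add: integral_ideal_iff)
  qed
  thus ?thesis using assms OK_module_cnj cnj_mem_OK by (auto simp: integral_ideal_iff)
qed

text \<open>The inverse of the fractional ideal \<open>latt z\<close>, whose norm is \<open>1 / A\<close>.\<close>
definition inv_latt :: "int \<Rightarrow> complex \<Rightarrow> complex set" where
  "inv_latt A z = smul (of_int A) (cnj ` latt z)"

lemma OK_module_inv_latt: "cm_point D z A B C \<Longrightarrow> OK_module D (inv_latt A z)"
  unfolding inv_latt_def by (intro OK_module_smul OK_module_cnj OK_module_latt)

lemma inv_latt_memI: "x \<in> latt z \<Longrightarrow> of_int A * cnj x \<in> inv_latt A z"
  by (auto simp: inv_latt_def intro: smul_memI)

text \<open>The roots of the quadratic equation are \<open>z\<close> and its conjugate; these are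
  their product and their sum, cleared of the denominator \<open>A\<close>.\<close>

lemma cm_point_norm:
  assumes "cm_point D z A B C"
  shows "of_int A * (z * cnj z) = of_int C" "of_int A * z + of_int A * cnj z = - of_int B"
proof -
  note c = cm_pointD[OF assms]
  have z': "of_int A * cnj z = (- of_int B - sqrtD D) / 2"
    using arg_cong[OF c(6), of cnj] by (simp add: cnj_sqrtD)
  have "4 * (of_int A * (of_int A * (z * cnj z))) = 4 * ((of_int A * z) * (of_int A * cnj z))"
    by (simp add: mult_ac)
  also have "\<dots> = of_int B * of_int B - sqrtD D * sqrtD D"
    unfolding c(6) z' by (simp add: field_simps)
  also have "\<dots> = of_int (B\<^sup>2 - D)"
    by (simp add: sqrtD_square[OF c(4)] power2_eq_square)
  also have "B\<^sup>2 - D = 4 * (A * C)" using c(5) by simp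
  finally have "complex_of_int A * (of_int A * (z * cnj z)) = of_int A * of_int C" by simp
  thus "of_int A * (z * cnj z) = of_int C" using c(3) by (simp only: mult_cancel_left) auto
  show "of_int A * z + of_int A * cnj z = - of_int B"
    unfolding c(6) z' by (simp add: field_simps)
qed

text \<open>The product is spanned over the integers by \<open>A\<close>, \<open>A z\<close>,
  \<open>A cnj z\<close> and \<open>A z cnj z = C\<close>, all in \<open>OK D\<close>. It contains
  \<open>A\<close>, the trace \<open>- B\<close> and \<open>C\<close>, which are coprime, and hence
  it contains 1.\<close>

lemma latt_inv_latt:
  assumes "cm_point D z A B C"
  shows "idl_mult (latt z) (inv_latt A z) = OK D"
proof
  note c = cm_pointD[OF assms] and nrm = cm_point_norm[OF assms]
  have OKgrp: "add_subgroup (OK D)" by (simp add: OK_eq_latt add_subgroup_latt)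
  have Az: "of_int A * z \<in> OK D"
    using self_mem_latt mult_ring_latt[OF c(1,2)] cm_point_mult_ring[OF assms] by metis
  have Az': "of_int A * cnj z \<in> OK D" using cnj_mem_OK[OF Az] by simp
  show "idl_mult (latt z) (inv_latt A z) \<subseteq> OK D"
  proof (rule idl_mult_least[OF OKgrp])
    fix u v assume "u \<in> latt z" "v \<in> inv_latt A z"
    then obtain t where t: "t \<in> latt z" "v = of_int A * cnj t"
      by (auto simp: inv_latt_def smul_def)
    obtain m n where u: "u = of_int m + of_int n * z" using \<open>u \<in> latt z\<close> by (rule lattE)
    obtain m' n' where "t = of_int m' + of_int n' * z" using t(1) by (rule lattE)
    with t(2) have v: "v = of_int A * cnj (of_int m' + of_int n' * z)" by simp
    have "u * v = of_int (m * m' * A) + of_int (m * n') * (of_int A * cnj z)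
        + of_int (n * m') * (of_int A * z) + of_int (n * n') * (of_int A * (z * cnj z))"
      by (simp add: u v algebra_simps)
    also have "\<dots> \<in> OK D"
      unfolding nrm(1)
      by (intro add_subgroupD(2)[OF OKgrp] add_subgroup_of_int_mult[OF OKgrp] of_int_mem_OK Az Az')
    finally show "u * v \<in> OK D" .
  qed
  let ?P = "idl_mult (latt z) (inv_latt A z)"
  have P: "OK_module D ?P" by (rule OK_module_idl_mult[OF OK_module_latt[OF assms]])
  note Pgrp = add_subgroup_idl_mult[of "latt z" "inv_latt A z"]
  have mem: "u * (of_int A * cnj v) \<in> ?P" if "u \<in> latt z" "v \<in> latt z" for u v
    by (intro idl_mult_mem inv_latt_memI that)
  have 1: "of_int A \<in> ?P" using mem[OF one_mem_latt one_mem_latt] by simp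
  have "z * (of_int A * cnj 1) + 1 * (of_int A * cnj z) \<in> ?P"
    by (intro add_subgroupD(2)[OF Pgrp] mem one_mem_latt self_mem_latt)
  hence 2: "- of_int B \<in> ?P" using nrm(2) by (simp add: mult.commute)
  have 3: "of_int C \<in> ?P" using mem[OF self_mem_latt self_mem_latt] nrm(1)
    by (simp add: mult.left_commute)
  obtain p q r where pqr: "p * A + q * B + r * C = 1" using prim_eq_bezout c(2) by blast
  have "of_int p * of_int A + of_int (- q) * (- of_int B) + of_int r * of_int C \<in> ?P"
    by (intro add_subgroupD(2)[OF Pgrp] add_subgroup_of_int_mult[OF Pgrp] 1 2 3)
  also have "of_int p * of_int A + of_int (- q) * (- of_int B) + of_int r * of_int C
      = complex_of_int (p * A + q * B + r * C)" by simp
  finally have "1 \<in> ?P" by (simp only: pqr of_int_1)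
  thus "OK D \<subseteq> ?P" using OK_moduleD(2)[OF P _ \<open>1 \<in> ?P\<close>] by auto
qed

section \<open>Indices of lattices\<close>

definition span2 :: "complex \<Rightarrow> complex \<Rightarrow> complex set" where
  "span2 x y = {of_int k * x + of_int l * y | k l. True}"

lemma smul_latt_eq_span2: "smul s (latt z) = span2 s (s * z)"
proof -
  have *: "s * (of_int m + of_int n * z) = of_int m * s + of_int n * (s * z)" for m n
    by (simp add: algebra_simps)
  have "smul s (latt z) = {s * (of_int m + of_int n * z) | m n. True}"
    by (auto simp: smul_def latt_def)
  thus ?thesis by (simp only: span2_def *)
qed

text \<open>\<open>Im (cnj x * y)\<close> is the oriented area of the parallelogram on
  \<open>x\<close> and \<open>y\<close>; passing to a sublattice multiplies it by the determinant of
  the change of generators.\<close>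

lemma span2_area_dvd:
  assumes "span2 x' y' \<subseteq> span2 x y"
  shows "\<exists>k :: int. Im (cnj x' * y') = of_int k * Im (cnj x * y)"
proof -
  have "of_int 1 * x' + of_int 0 * y' \<in> span2 x' y'" "of_int 0 * x' + of_int 1 * y' \<in> span2 x' y'"
    unfolding span2_def by blast+
  hence "x' \<in> span2 x y" "y' \<in> span2 x y" using assms by auto
  then obtain a b c d where "x' = of_int a * x + of_int b * y" "y' = of_int c * x + of_int d * y"
    unfolding span2_def by blast
  hence "Im (cnj x' * y') = of_int (a * d - b * c) * Im (cnj x * y)"
    by (simp add: algebra_simps)
  thus ?thesis by blast
qed

text \<open>Each area is an integer multiple of the other; a multiplier 0 forces both to
  vanish.\<close>

lemma span2_area:
  assumes "span2 x y = span2 x' y'"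
  shows "\<bar>Im (cnj x * y)\<bar> = \<bar>Im (cnj x' * y')\<bar>"
proof -
  have le: "\<bar>r\<bar> \<le> \<bar>s\<bar>" if "s = of_int k * r" "r = of_int l * s" for r s :: real and k l :: int
  proof (cases "k = 0")
    case False
    hence "1 \<le> \<bar>real_of_int k\<bar>" by linarith
    hence "1 * \<bar>r\<bar> \<le> \<bar>real_of_int k\<bar> * \<bar>r\<bar>" by (rule mult_right_mono) simp
    thus ?thesis using that(1) by (simp add: abs_mult)
  next
    case True
    hence "s = 0" using that(1) by simp
    hence "r = 0" using that(2) by simp
    thus ?thesis by simp
  qed
  obtain k l :: int where "Im (cnj x' * y') = of_int k * Im (cnj x * y)"
    "Im (cnj x * y) = of_int l * Im (cnj x' * y')"
    using span2_area_dvd[OF equalityD1[OF assms]] span2_area_dvd[OF equalityD2[OF assms]] by blast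
  from le[OF this] le[OF this(2,1)] show ?thesis by (rule antisym)
qed

text \<open>The generator is the least positive element: a nonzero remainder of division by it would
  be a smaller one.\<close>

lemma int_subgroup_generator:
  fixes S :: "int set"
  assumes "\<And>x y. x \<in> S \<Longrightarrow> y \<in> S \<Longrightarrow> x - y \<in> S" "x0 \<in> S" "x0 > 0"
  shows "\<exists>n\<in>S. n > 0 \<and> (\<forall>x\<in>S. n dvd x)"
proof -
  define n where "n = int (LEAST k. k > 0 \<and> int k \<in> S)"
  have "nat x0 > 0 \<and> int (nat x0) \<in> S" using assms by simp
  from LeastI[of "\<lambda>k. k > 0 \<and> int k \<in> S", OF this]
  have n: "n > 0" "n \<in> S" unfolding n_def by auto
  have least: "n \<le> x" if "x > 0" "x \<in> S" for x
    unfolding n_def using Least_le[of "\<lambda>k. k > 0 \<and> int k \<in> S" "nat x"] that by simp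
  have zero: "0 \<in> S" using assms(1)[OF n(2) n(2)] by simp
  have neg: "- x \<in> S" if "x \<in> S" for x using assms(1)[OF zero that] by simp
  have add: "x + y \<in> S" if "x \<in> S" "y \<in> S" for x y
    using assms(1)[OF that(1) neg[OF that(2)]] by simp
  have mul: "int k * n \<in> S" for k
    by (induction k) (use zero n add in \<open>auto simp: algebra_simps\<close>)
  have mul': "k * n \<in> S" for k
    using mul[of "nat k"] neg[OF mul[of "nat (- k)"]] by (cases "k \<ge> 0") auto
  have "n dvd x" if "x \<in> S" for x
  proof (rule ccontr)
    assume "\<not> n dvd x"
    hence "x mod n \<noteq> 0" by (simp add: dvd_eq_mod_eq_0)
    moreover have "x mod n \<ge> 0" "x mod n < n" using n by simp_all
    moreover have "x mod n \<in> S"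
      using assms(1)[OF that mul'[of "x div n"]] by (simp add: minus_div_mult_eq_mod)
    ultimately show False using least[of "x mod n"] by auto
  qed
  thus ?thesis using n by blast
qed

text \<open>Hermite normal form: \<open>n\<close> generates the integers in \<open>M\<close>, and
  \<open>d\<close> generates the coefficients of \<open>w\<close> that occur in \<open>M\<close>.
  The multiple \<open>n0\<close> of the whole lattice guarantees that both are nonzero.\<close>

lemma sublattice_hnf:
  assumes "add_subgroup M" "M \<subseteq> latt w" "n0 > 0" "smul (of_int n0) (latt w) \<subseteq> M"
  obtains n e d :: int where "n > 0" "d > 0" "M = span2 (of_int n) (of_int e + of_int d * w)"
proof -
  note M = add_subgroupD[OF assms(1)] add_subgroup_of_int_mult[OF assms(1)]
  have n0: "of_int n0 \<in> M" "of_int n0 * w \<in> M"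
    using assms(4) smul_memI[OF one_mem_latt, of "of_int n0" w]
      smul_memI[OF self_mem_latt, of "of_int n0" w] by auto
  have "\<exists>n\<in>{m. of_int m \<in> M}. n > 0 \<and> (\<forall>x\<in>{m. of_int m \<in> M}. n dvd x)"
  proof (rule int_subgroup_generator[of _ n0])
    fix x y assume "x \<in> {m. of_int m \<in> M}" "y \<in> {m. of_int m \<in> M}"
    thus "x - y \<in> {m. of_int m \<in> M}" using M(4)[of "of_int x" "of_int y"] by simp
  qed (use n0 assms(3) in auto)
  then obtain n where n: "n > 0" "of_int n \<in> M" "\<And>x. of_int x \<in> M \<Longrightarrow> n dvd x" by auto
  let ?S = "{d. \<exists>e. of_int e + of_int d * w \<in> M}"
  have "\<exists>d\<in>?S. d > 0 \<and> (\<forall>x\<in>?S. d dvd x)"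
  proof (rule int_subgroup_generator[of _ n0])
    fix x y assume "x \<in> ?S" "y \<in> ?S"
    then obtain e e' where "of_int e + of_int x * w \<in> M" "of_int e' + of_int y * w \<in> M" by auto
    from M(4)[OF this] have "of_int (e - e') + of_int (x - y) * w \<in> M"
      by (simp add: algebra_simps)
    thus "x - y \<in> ?S" by blast
  next
    have "of_int 0 + of_int n0 * w \<in> M" using n0(2) by simp
    thus "n0 \<in> ?S" by blast
  qed (rule assms(3))
  then obtain d e where d: "d > 0" "of_int e + of_int d * w \<in> M"
    "\<And>x e. of_int e + of_int x * w \<in> M \<Longrightarrow> d dvd x" by blast
  have "M = span2 (of_int n) (of_int e + of_int d * w)"
  proof
    show "span2 (of_int n) (of_int e + of_int d * w) \<subseteq> M"
      unfolding span2_def using M(2,5) n(2) d(2) by blast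
    show "M \<subseteq> span2 (of_int n) (of_int e + of_int d * w)"
    proof
      fix x assume x: "x \<in> M"
      then obtain p q where pq: "x = of_int p + of_int q * w" using assms(2) lattE by blast
      then obtain l where l: "q = d * l" using d(3) x by blast
      \<comment> \<open>Subtracting the right multiple of the second generator leaves an integer in
        \<open>M\<close>, hence a multiple of \<open>n\<close>.\<close>
      have "x - of_int l * (of_int e + of_int d * w) = of_int (p - l * e)"
        by (simp add: pq l algebra_simps)
      moreover have "x - of_int l * (of_int e + of_int d * w) \<in> M"
        by (rule M(4)[OF x M(5)[OF d(2)]])
      ultimately have "n dvd p - l * e" using n(3) by simp
      then obtain k where "p - l * e = n * k" unfolding dvd_def by blast
      hence "p = n * k + l * e" by simp
      hence "x = of_int k * of_int n + of_int l * (of_int e + of_int d * w)"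
        by (simp add: pq l algebra_simps)
      thus "x \<in> span2 (of_int n) (of_int e + of_int d * w)" unfolding span2_def by blast
    qed
  qed
  thus ?thesis using that n d by blast
qed

text \<open>The numbers \<open>i + j w\<close> with \<open>0 <= i < n\<close> and
  \<open>0 <= j < d\<close> represent every coset exactly once.\<close>

lemma card_cosets_hnf:
  assumes "Im w > 0" "n > 0" "d > 0" and M: "M = span2 (of_int n) (of_int e + of_int d * w)"
    and "add_subgroup M"
  shows "card ((\<lambda>x. {x + y | y. y \<in> M}) ` latt w) = nat (n * d)"
proof -
  let ?c = "\<lambda>x. {x + y | y. y \<in> M}"
  note grp = add_subgroupD[OF assms(5)]
  have c_eq: "?c x = ?c x' \<longleftrightarrow> x - x' \<in> M" for x x'
  proof
    assume "?c x = ?c x'"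
    moreover have "x + 0 \<in> ?c x" using grp(1) by blast
    ultimately obtain y where "x + 0 = x' + y" "y \<in> M" by blast
    thus "x - x' \<in> M" by simp
  next
    assume *: "x - x' \<in> M"
    show "?c x = ?c x'"
    proof (intro equalityI subsetI)
      fix u assume "u \<in> ?c x"
      then obtain y where y: "y \<in> M" "u = x + y" by blast
      hence "u = x' + ((x - x') + y)" by simp
      thus "u \<in> ?c x'" using grp(2)[OF * y(1)] by blast
    next
      fix u assume "u \<in> ?c x'"
      then obtain y where y: "y \<in> M" "u = x' + y" by blast
      hence "u = x + (y - (x - x'))" by simp
      thus "u \<in> ?c x" using grp(4)[OF y(1) *] by blast
    qed
  qed
  define g where "g = (\<lambda>(i, j). ?c (of_int i + of_int j * w))"
  have inM: "of_int a + of_int b * w \<in> M \<longleftrightarrow> (\<exists>l. b = l * d \<and> n dvd (a - l * e))" for a b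
  proof
    assume "of_int a + of_int b * w \<in> M"
    then obtain k l where "of_int a + of_int b * w = of_int k * of_int n + of_int l * (of_int e + of_int d * w)"
      unfolding M span2_def by blast
    hence "of_int a + of_int b * w = of_int (k * n + l * e) + of_int (l * d) * w"
      by (simp add: algebra_simps)
    from latt_coord_unique[OF _ this] assms(1) show "\<exists>l. b = l * d \<and> n dvd (a - l * e)" by auto
  next
    assume "\<exists>l. b = l * d \<and> n dvd (a - l * e)"
    then obtain l k where "b = l * d" "a - l * e = n * k" unfolding dvd_def by blast
    hence "a = n * k + l * e" "b = l * d" by auto
    hence "of_int a + of_int b * w = of_int k * of_int n + of_int l * (of_int e + of_int d * w)"
      by (simp add: algebra_simps)
    thus "of_int a + of_int b * w \<in> M" unfolding M span2_def by blast
  qed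
  have diff: "(of_int i + of_int j * w) - (of_int i' + of_int j' * w) = of_int (i - i') + of_int (j - j') * w"
    for i j i' j' :: int by (simp add: algebra_simps)
  have "bij_betw g ({0..<n} \<times> {0..<d}) (?c ` latt w)"
    unfolding bij_betw_def
  proof (intro conjI inj_onI)
    fix p q assume p: "p \<in> {0..<n} \<times> {0..<d}" and q: "q \<in> {0..<n} \<times> {0..<d}" and "g p = g q"
    then have "?c (of_int (fst p) + of_int (snd p) * w) = ?c (of_int (fst q) + of_int (snd q) * w)"
      by (simp add: g_def case_prod_beta)
    then obtain l where "snd p - snd q = l * d" and l: "n dvd (fst p - fst q - l * e)"
      unfolding c_eq diff inM by blast
    have small: "a = b" if "0 \<le> a" "a < m" "0 \<le> b" "b < m" "m dvd (a - b)" for a b m :: int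
    proof -
      have "a mod m = b mod m" using that(5) by (simp only: mod_eq_dvd_iff)
      thus ?thesis using that(1-4) by simp
    qed
    have b: "0 \<le> fst p" "fst p < n" "0 \<le> fst q" "fst q < n" "0 \<le> snd p" "snd p < d" "0 \<le> snd q"
      "snd q < d" using p q by auto
    have 1: "snd p = snd q"
      by (rule small[OF b(5-8)]) (simp add: \<open>snd p - snd q = l * d\<close>)
    hence "l = 0" using \<open>snd p - snd q = l * d\<close> assms(3) by simp
    hence "fst p = fst q" by (intro small[OF b(1-4)]) (use l in simp)
    with 1 show "p = q" by (simp add: prod_eq_iff)
  next
    show "g ` ({0..<n} \<times> {0..<d}) = ?c ` latt w"
    proof
      show "g ` ({0..<n} \<times> {0..<d}) \<subseteq> ?c ` latt w"
        using latt_memI by (auto simp: g_def)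
      show "?c ` latt w \<subseteq> g ` ({0..<n} \<times> {0..<d})"
      proof
        fix X assume "X \<in> ?c ` latt w"
        then obtain a b where X: "X = ?c (of_int a + of_int b * w)" by (auto simp: latt_iff)
        \<comment> \<open>Reduction to the box: first the coefficient of \<open>w\<close> modulo
          \<open>d\<close>, then, after the second generator has been subtracted \<open>l\<close>
          times, the integer part modulo \<open>n\<close>.\<close>
        define j where "j = b mod d"
        define l where "l = b div d"
        define i where "i = (a - l * e) mod n"
        have "b - j = l * d" by (simp add: j_def l_def minus_mod_eq_div_mult)
        moreover have "n dvd ((a - i) - l * e)"
        proof -
          have "(a - i) - l * e = (a - l * e) - (a - l * e) mod n" by (simp add: i_def)
          thus ?thesis by (simp add: minus_mod_eq_mult_div)
        qed
        ultimately have "?c (of_int a + of_int b * w) = ?c (of_int i + of_int j * w)"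
          unfolding c_eq diff inM by blast
        hence "X = g (i, j)" by (simp add: X g_def)
        moreover have "(i, j) \<in> {0..<n} \<times> {0..<d}" using assms by (simp add: i_def j_def)
        ultimately show "X \<in> g ` ({0..<n} \<times> {0..<d})" by blast
      qed
    qed
  qed
  hence "card (?c ` latt w) = card ({0..<n} \<times> {0..<d})" by (rule bij_betw_same_card[symmetric])
  thus ?thesis using assms by (simp add: card_cartesian_product nat_mult_distrib)
qed

text \<open>The normal form gives the index \<open>n d\<close>, which is a quotient of areas, and
  the area is the same for every basis. Thus the index can be computed from any generators.\<close>

lemma card_cosets_span2:
  assumes "Im w > 0" "M = span2 x y" "add_subgroup M" "M \<subseteq> latt w" "n0 > 0"
    "smul (of_int n0) (latt w) \<subseteq> M"
  shows "real (card ((\<lambda>x. {x + y | y. y \<in> M}) ` latt w)) = \<bar>Im (cnj x * y)\<bar> / Im w"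
    "finite ((\<lambda>x. {x + y | y. y \<in> M}) ` latt w)"
proof -
  obtain n e d where h: "n > 0" "d > 0" "M = span2 (of_int n) (of_int e + of_int d * w)"
    using sublattice_hnf[OF assms(3-6)] by blast
  have card: "card ((\<lambda>x. {x + y | y. y \<in> M}) ` latt w) = nat (n * d)"
    by (rule card_cosets_hnf[OF assms(1) h assms(3)])
  \<comment> \<open>A positive \<open>card\<close> gives finiteness, because \<open>card\<close> of
    an infinite set is 0.\<close>
  hence "card ((\<lambda>x. {x + y | y. y \<in> M}) ` latt w) > 0" using h by simp
  thus "finite ((\<lambda>x. {x + y | y. y \<in> M}) ` latt w)" by (rule card_ge_0_finite)
  have "span2 x y = span2 (of_int n) (of_int e + of_int d * w)" using h assms(2) by simp
  from span2_area[OF this] have "\<bar>Im (cnj x * y)\<bar> = real_of_int (n * d) * Im w"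
    using h(1,2) assms(1) by (simp add: abs_mult)
  thus "real (card ((\<lambda>x. {x + y | y. y \<in> M}) ` latt w)) = \<bar>Im (cnj x * y)\<bar> / Im w"
    unfolding card using h(1,2) assms(1) by simp
qed

section \<open>Integral ideals\<close>

lemma prim_eq_exists:
  assumes "of_int a * z\<^sup>2 + of_int b * z + of_int c = (0 :: complex)" "a > 0"
  shows "\<exists>A B C. prim_eq z A B C"
proof -
  define g where "g = gcd (gcd a b) c"
  have g: "g > 0" using assms(2) by (simp add: g_def)
  have "g dvd a" "g dvd b" "g dvd c"
    unfolding g_def using dvd_trans[OF gcd_dvd1[of "gcd a b" c]] by auto
  then obtain A B C where abc: "a = g * A" "b = g * B" "c = g * C" unfolding dvd_def by blast
  have "gcd (gcd (g * A) (g * B)) (g * C) = g * gcd (gcd A B) C"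
    using g by (simp add: gcd_mult_left abs_mult)
  hence "g * gcd (gcd A B) C = g * 1" unfolding abc[symmetric] g_def[symmetric] by simp
  hence "gcd (gcd A B) C = 1" using g by (simp only: mult_cancel_left) simp
  moreover have "A > 0" using assms(2) g by (simp add: abc zero_less_mult_iff)
  moreover have "of_int g * (of_int A * z\<^sup>2 + of_int B * z + of_int C) = 0"
    using assms(1) by (simp add: abc algebra_simps)
  hence "of_int A * z\<^sup>2 + of_int B * z + of_int C = 0" using g by (simp only: mult_eq_0_iff) simp
  ultimately have "prim_eq z A B C" unfolding prim_eq_def by blast
  thus ?thesis by blast
qed

text \<open>For nonzero \<open>x\<close> in the ideal, \<open>cnj x * x\<close> is in the ideal too;
  being a positive real element of \<open>OK D\<close>, it is an integer.\<close>

lemma integral_ideal_contains_int: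
  assumes "fund_disc D" "integral_ideal D I"
  obtains n :: int where "n > 0" "smul (of_int n) (OK D) \<subseteq> I"
proof -
  have I: "OK_module D I" "I \<subseteq> OK D" "I \<noteq> {0}" using assms by (auto simp: integral_ideal_iff)
  obtain x where x: "x \<in> I" "x \<noteq> 0" using I add_subgroupD(1)[OF OK_moduleD(1)] by blast
  have xx: "cnj x * x \<in> I" using I x cnj_mem_OK OK_moduleD(2) by blast
  then obtain m n where mn: "cnj x * x = of_int m + of_int n * om D"
    using I(2) lattE unfolding OK_eq_latt by blast
  have "Im (cnj x * x) = 0" by simp
  hence "n = 0" unfolding mn using Im_om_pos[OF fund_disc_neg[OF assms(1)]] by simp
  hence m: "cnj x * x = of_int m" using mn by simp
  have "Re (cnj x * x) > 0" using x by (simp add: complex_eq_iff sum_squares_gt_zero_iff)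
  hence "m > 0" unfolding m by simp
  moreover have "smul (of_int m) (OK D) \<subseteq> I"
    using OK_moduleD(2)[OF I(1) _ xx[unfolded m]] by (auto simp: smul_def mult.commute)
  ultimately show ?thesis using that by blast
qed

text \<open>The normal form of \<open>I\<close> has basis \<open>n\<close> and
  \<open>e + d om\<close>, and \<open>z\<close> is the quotient of the two. It satisfies a quadratic
  equation, and \<open>OK D\<close> stabilises its lattice since \<open>I\<close> is an ideal, so
  \<open>cm_pointI\<close> applies.\<close>

lemma integral_ideal_eq_smul_latt:
  assumes "fund_disc D" "integral_ideal D I"
  obtains x z A B C where "x \<noteq> 0" "cm_point D z A B C" "I = smul x (latt z)"
proof -
  have I: "OK_module D I" "I \<subseteq> OK D" "I \<noteq> {0}" using assms by (auto simp: integral_ideal_iff)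
  obtain n0 where n0: "n0 > 0" "smul (of_int n0) (OK D) \<subseteq> I"
    using integral_ideal_contains_int[OF assms] by blast
  obtain n e d where h: "n > 0" "d > 0" "I = span2 (of_int n) (of_int e + of_int d * om D)"
    using sublattice_hnf[OF OK_moduleD(1)[OF I(1)] I(2)[unfolded OK_eq_latt] n0(1)
        n0(2)[unfolded OK_eq_latt]] by blast
  define z where "z = (of_int e + of_int d * om D) / of_int n"
  have nz: "of_int n * z = of_int e + of_int d * om D" using h by (simp add: z_def)
  have Ieq: "I = smul (of_int n) (latt z)"
    unfolding smul_latt_eq_span2 nz using h(3) .
  have "Im (of_int n * z) > 0" unfolding nz
    using h Im_om_pos[OF fund_disc_neg[OF assms(1)]] by simp
  hence Imz: "Im z > 0" using h by (simp add: zero_less_mult_iff)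
  define l where "l = (D\<^sup>2 - D) div 4"
  have om: "(om D)\<^sup>2 = of_int D * om D - of_int l"
    using cm_pointD(7)[OF cm_point_om[OF assms(1)]] by (simp add: l_def algebra_simps)
  \<comment> \<open>This is the equation of \<open>om D\<close> multiplied by \<open>d^2\<close>,
    with \<open>n z - e\<close> substituted for \<open>d om\<close>.\<close>
  have "of_int (n * n) * z\<^sup>2 + of_int (- n * (2 * e + d * D)) * z + of_int (e\<^sup>2 + e * d * D + d\<^sup>2 * l)
      = (of_int n * z)\<^sup>2 - of_int (2 * e + d * D) * (of_int n * z) + of_int (e\<^sup>2 + e * d * D + d\<^sup>2 * l)"
    by (simp add: power2_eq_square algebra_simps)
  also have "\<dots> = of_int d * of_int d * ((om D)\<^sup>2 - of_int D * om D + of_int l)"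
    unfolding nz by (simp add: power2_eq_square algebra_simps)
  also have "\<dots> = 0" by (simp add: om)
  finally obtain A B C where ABC: "prim_eq z A B C"
    using prim_eq_exists[of "n * n" z "- n * (2 * e + d * D)"] h(1) mult_pos_pos by blast
  have "OK D \<subseteq> mult_ring (latt z)"
    unfolding mult_ring_def
  proof safe
    fix r u assume r: "r \<in> OK D" and u: "u \<in> latt z"
    have "r * (of_int n * u) \<in> I" using OK_moduleD(2)[OF I(1) r] u Ieq smul_memI by blast
    hence "of_int n * (r * u) \<in> smul (of_int n) (latt z)" unfolding Ieq by (simp add: mult_ac)
    thus "r * u \<in> latt z" using h by (subst (asm) smul_mem_iff) auto
  qed
  hence "cm_point D z A B C" using cm_pointI assms(1) Imz ABC by blast
  thus ?thesis using that[of "of_int n"] Ieq h by auto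
qed

lemma integral_ideal_inverse:
  assumes "fund_disc D" "integral_ideal D I"
  obtains J where "OK_module D J" "idl_mult I J = OK D"
proof -
  obtain x z A B C where x: "x \<noteq> 0" "cm_point D z A B C" "I = smul x (latt z)"
    using integral_ideal_eq_smul_latt[OF assms] by blast
  have "idl_mult I (smul (inverse x) (inv_latt A z)) = OK D"
    using x(1) latt_inv_latt[OF x(2)]
    by (simp add: x(3) idl_mult_smul_left idl_mult_smul_right smul_smul)
  thus ?thesis using that OK_module_smul[OF OK_module_inv_latt[OF x(2)]] by blast
qed

text \<open>With \<open>N = inv_latt A z\<close>, multiplying \<open>w N \<subseteq> OK D\<close> by
  the inverse \<open>latt z\<close> of \<open>N\<close> turns it into
  \<open>w \<in> latt z\<close>.\<close>

lemma integral_ideal_smul_inv_latt: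
  assumes "cm_point D z A B C" "w \<noteq> 0"
  shows "integral_ideal D (smul w (inv_latt A z)) \<longleftrightarrow> w \<in> latt z"
proof
  note c = cm_pointD[OF assms(1)]
  assume w: "w \<in> latt z"
  have "smul w (inv_latt A z) \<subseteq> OK D"
    unfolding latt_inv_latt[OF assms(1), symmetric] smul_def using idl_mult_mem[OF w] by blast
  moreover have "w * (of_int A * cnj 1) \<in> smul w (inv_latt A z)"
    by (intro smul_memI inv_latt_memI one_mem_latt)
  moreover have "w * (of_int A * cnj 1) \<noteq> 0" using assms(2) c(3) by simp
  ultimately have "smul w (inv_latt A z) \<subseteq> OK D" "smul w (inv_latt A z) \<noteq> {0}" by blast+
  thus "integral_ideal D (smul w (inv_latt A z))"
    unfolding integral_ideal_iff using OK_module_smul OK_module_inv_latt assms by blast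
next
  assume "integral_ideal D (smul w (inv_latt A z))"
  hence "smul w (inv_latt A z) \<subseteq> OK D" by (simp add: integral_ideal_iff)
  hence "idl_mult (smul w (inv_latt A z)) (latt z) \<subseteq> idl_mult (OK D) (latt z)"
    by (intro idl_mult_mono) auto
  hence "smul w (OK D) \<subseteq> latt z"
    unfolding idl_mult_smul_left idl_mult_comm[of "inv_latt A z"] latt_inv_latt[OF assms(1)]
      idl_mult_OK_left[OF OK_module_latt[OF assms(1)]] .
  thus "w \<in> latt z" using smul_memI[OF of_int_mem_OK[of 1], of w] by auto
qed

text \<open>The norm is an index, hence a quotient of areas: the conjugate lattice scaled by
  \<open>w A\<close> has area \<open>(cmod w)^2 A^2 Im z\<close>, and
  \<open>Im z = Im (om D) / A\<close>.\<close>

lemma idl_norm_smul_inv_latt: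
  assumes "fund_disc D" "cm_point D z A B C" "w \<in> latt z" "w \<noteq> 0"
  shows "real (idl_norm D (smul w (inv_latt A z))) = of_int A * (cmod w)\<^sup>2"
proof -
  note c = cm_pointD[OF assms(2)]
  have I: "integral_ideal D (smul w (inv_latt A z))"
    using integral_ideal_smul_inv_latt assms by blast
  obtain n0 where n0: "n0 > 0" "smul (of_int n0) (OK D) \<subseteq> smul w (inv_latt A z)"
    using integral_ideal_contains_int[OF assms(1) I] by blast
  have sub: "cnj ` latt z \<subseteq> latt (cnj z)" for z
  proof
    fix x assume "x \<in> cnj ` latt z"
    then obtain m n where "x = cnj (of_int m + of_int n * z)" by (auto elim!: lattE)
    thus "x \<in> latt (cnj z)" using latt_memI[of m n "cnj z"] by simp
  qed
  have "cnj ` latt z = latt (cnj z)"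
    using sub[of z] image_mono[OF sub[of "cnj z"], of cnj] by simp
  hence sp: "smul w (inv_latt A z) = span2 (w * of_int A) (w * of_int A * cnj z)"
    unfolding inv_latt_def smul_smul by (simp only: smul_latt_eq_span2)
  have "real (idl_norm D (smul w (inv_latt A z))) =
      \<bar>Im (cnj (w * of_int A) * (w * of_int A * cnj z))\<bar> / Im (om D)"
    unfolding idl_norm_def OK_eq_latt
    by (rule card_cosets_span2(1)[OF Im_om_pos[OF c(4)] sp _ _ n0(1)])
       (use I n0 in \<open>auto simp: integral_ideal_iff OK_module_def OK_eq_latt\<close>)
  also have "cnj (w * of_int A) * (w * of_int A * cnj z) = of_real ((cmod w)\<^sup>2 * (of_int A)\<^sup>2) * cnj z"
    unfolding of_real_mult complex_norm_square by (simp add: power2_eq_square mult_ac)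
  also have "\<bar>Im \<dots>\<bar> = (cmod w)\<^sup>2 * (of_int A)\<^sup>2 * Im z"
    using c(1) by (simp add: abs_mult)
  also have "\<dots> / Im (om D) = of_int A * (cmod w)\<^sup>2"
    using c(3) Im_om_pos[OF c(4)] unfolding cm_point_Im[OF assms(2)]
    by (simp add: power2_eq_square field_simps)
  finally show ?thesis .
qed

lemma integral_idealD:
  assumes "integral_ideal D I"
  shows "OK_module D I" "I \<subseteq> OK D" "I \<noteq> {0}"
  using assms by (auto simp: integral_ideal_iff)

lemma integral_ideal_OK: "fund_disc D \<Longrightarrow> integral_ideal D (OK D)"
  unfolding integral_ideal_iff using OK_module_OK of_int_mem_OK[of 1 D] by auto

lemma integral_ideal_idl_mult:
  assumes "fund_disc D" "integral_ideal D I" "integral_ideal D J"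
  shows "integral_ideal D (idl_mult I J)"
proof -
  note I = integral_idealD[OF assms(2)] and J = integral_idealD[OF assms(3)]
  have "idl_mult I J \<subseteq> OK D"
    using OK_ring[OF assms(1)] I(2) J(2) by (intro idl_mult_least) auto
  moreover obtain x y where "x \<in> I" "x \<noteq> 0" "y \<in> J" "y \<noteq> 0"
    using I(3) J(3) add_subgroupD(1)[OF OK_moduleD(1)[OF I(1)]]
      add_subgroupD(1)[OF OK_moduleD(1)[OF J(1)]] by blast
  hence "x * y \<in> idl_mult I J" "x * y \<noteq> 0" using idl_mult_mem by auto
  ultimately show ?thesis unfolding integral_ideal_iff using OK_module_idl_mult[OF I(1)] by blast
qed

text \<open>Stated for submodules of \<open>OK D\<close>, so that the zero module is covered:
  \<open>w\<close> may vanish in the modules \<open>smul w (inv_latt A z)\<close> of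
  \<open>coprime_shift\<close>.\<close>

lemma coprime_idl_iff:
  assumes "fund_disc D" "OK_module D I" "I \<subseteq> OK D" "OK_module D J" "J \<subseteq> OK D"
  shows "coprime_idl D I J \<longleftrightarrow> (\<exists>x\<in>I. \<exists>y\<in>J. x + y = 1)"
proof
  assume "coprime_idl D I J"
  hence "1 \<in> idl_sum I J" using OK_ring(1)[OF assms(1)] by (simp add: coprime_idl_def)
  then obtain x y where "x \<in> I" "y \<in> J" "1 = x + y" unfolding idl_sum_def by blast
  thus "\<exists>x\<in>I. \<exists>y\<in>J. x + y = 1" by (intro bexI[of _ x] bexI[of _ y]) simp_all
next
  assume "\<exists>x\<in>I. \<exists>y\<in>J. x + y = 1"
  then obtain x y where xy: "x \<in> I" "y \<in> J" "x + y = 1" by blast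
  show "coprime_idl D I J" unfolding coprime_idl_def
  proof
    show "idl_sum I J \<subseteq> OK D"
      unfolding idl_sum_def using assms(3,5) add_subgroupD(2)[OF OK_ring(3)[OF assms(1)]] by blast
    show "OK D \<subseteq> idl_sum I J"
    proof
      fix r assume r: "r \<in> OK D"
      have "r = r * x + r * y" by (simp add: xy(3) flip: distrib_left)
      thus "r \<in> idl_sum I J" unfolding idl_sum_def
        using OK_moduleD(2)[OF assms(2) r xy(1)] OK_moduleD(2)[OF assms(4) r xy(2)] by blast
    qed
  qed
qed

lemma coprime_idl_iff':
  assumes "fund_disc D" "integral_ideal D I" "integral_ideal D J"
  shows "coprime_idl D I J \<longleftrightarrow> (\<exists>x\<in>I. \<exists>y\<in>J. x + y = 1)"
  by (intro coprime_idl_iff assms(1) integral_idealD[OF assms(2)] integral_idealD[OF assms(3)])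

text \<open>From \<open>x + y = 1\<close> and \<open>x' + y' = 1\<close> one gets
  \<open>x x' + (x y' + y) = 1\<close>.\<close>

lemma coprime_idl_mult:
  assumes "fund_disc D" "integral_ideal D I" "integral_ideal D J" "integral_ideal D cf"
    "coprime_idl D I cf" "coprime_idl D J cf"
  shows "coprime_idl D (idl_mult I J) cf"
proof -
  note cf = integral_idealD[OF assms(4)]
  note cfg = OK_moduleD(1)[OF cf(1)]
  obtain x y where xy: "x \<in> I" "y \<in> cf" "x + y = 1"
    using assms(5) unfolding coprime_idl_iff'[OF assms(1,2,4)] by blast
  obtain x' y' where xy': "x' \<in> J" "y' \<in> cf" "x' + y' = 1"
    using assms(6) unfolding coprime_idl_iff'[OF assms(1,3,4)] by blast
  have "x \<in> OK D" using xy integral_idealD(2)[OF assms(2)] by blast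
  hence "x * y' + y \<in> cf" by (intro add_subgroupD(2)[OF cfg] OK_moduleD(2)[OF cf(1)] xy xy')
  moreover have "x * x' \<in> idl_mult I J" using xy xy' by (intro idl_mult_mem)
  moreover have "x * x' + (x * y' + y) = 1"
  proof -
    have "x * x' + (x * y' + y) = x * (x' + y') + y" by (simp add: algebra_simps)
    thus ?thesis using xy xy' by simp
  qed
  ultimately show ?thesis
    unfolding coprime_idl_iff'[OF assms(1) integral_ideal_idl_mult[OF assms(1-3)] assms(4)] by blast
qed

section \<open>Ideal classes\<close>

lemma CM_reps_cm_point:
  assumes "fund_disc D" "CM_reps D h z" "a \<in> {1..h}" "prim_eq (z a) A B C"
  shows "cm_point D (z a) A B C"
proof -
  have "Im (z a) > 0" "mult_ring (latt (z a)) = OK D"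
    using assms(2,3) unfolding CM_reps_def by blast+
  thus ?thesis using cm_pointI[OF assms(1) _ assms(4)] by simp
qed

text \<open>The conjugate ideal is homothetic to the lattice of some CM point, hence to
  \<open>latt (z a)\<close> for a representative. Conjugating back gives a multiple of the conjugate
  lattice, that is, of \<open>inv_latt\<close>.\<close>

lemma CM_reps_cover:
  assumes "fund_disc D" "CM_reps D h z" "\<forall>a\<in>{1..h}. prim_eq (z a) (A a) (B a) (C a)"
    "integral_ideal D I"
  obtains a w where "a \<in> {1..h}" "w \<in> latt (z a)" "w \<noteq> 0" "I = smul w (inv_latt (A a) (z a))"
proof -
  obtain x v A' B' C' where v: "x \<noteq> 0" "cm_point D v A' B' C'" "cnj ` I = smul x (latt v)"
    using integral_ideal_eq_smul_latt[OF assms(1) integral_ideal_cnj[OF assms(4)]] by blast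
  obtain a s where a: "a \<in> {1..h}" "s \<noteq> 0" "smul s (latt v) = latt (z a)"
    using assms(2)[unfolded CM_reps_def, THEN conjunct2, THEN conjunct2, rule_format,
        OF cm_pointD(1)[OF v(2)] cm_point_mult_ring[OF v(2)]]
    unfolding smul_def by blast
  have cm: "cm_point D (z a) (A a) (B a) (C a)"
    by (rule CM_reps_cm_point[OF assms(1,2) a(1)]) (use assms(3) a(1) in blast)
  have A: "A a > 0" using cm_pointD(3)[OF cm] .
  \<comment> \<open>The last factor cancels the \<open>A a\<close> contained in
    \<open>inv_latt\<close>.\<close>
  define w where "w = cnj (x * inverse s) * inverse (of_int (A a))"
  have "latt v = smul (inverse s) (latt (z a))" using a(3) smul_eq_iff[OF a(2)] by blast
  hence "cnj ` cnj ` I = cnj ` smul (x * inverse s) (latt (z a))"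
    by (simp add: v(3) smul_smul)
  hence "I = smul (cnj (x * inverse s)) (cnj ` latt (z a))"
    unfolding cnj_image_cnj_image cnj_image_smul .
  also have "\<dots> = smul w (inv_latt (A a) (z a))"
    using A by (simp add: w_def inv_latt_def smul_smul mult.assoc)
  finally have I: "I = smul w (inv_latt (A a) (z a))" .
  have w0: "w \<noteq> 0" using A v(1) a(2) by (simp add: w_def)
  hence "w \<in> latt (z a)" using integral_ideal_smul_inv_latt[OF cm w0] assms(4) I by simp
  thus ?thesis using that[OF a(1) _ w0 I] by blast
qed

text \<open>Conjugating the equation turns it into a homothety between \<open>latt (z a)\<close> and
  \<open>latt (z b)\<close>, which distinct representatives do not admit.\<close>

lemma CM_reps_unique:
  assumes "CM_reps D h z" "a \<in> {1..h}" "b \<in> {1..h}" "A \<noteq> 0" "A' \<noteq> 0" "w \<noteq> 0" "w' \<noteq> 0"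
    "smul w (inv_latt A (z a)) = smul w' (inv_latt A' (z b))"
  shows "a = b"
proof (rule ccontr)
  assume ab: "a \<noteq> b"
  have "cnj ` smul w (inv_latt A (z a)) = cnj ` smul w' (inv_latt A' (z b))" using assms(8) by simp
  hence "smul (cnj w * of_int A) (latt (z a)) = smul (cnj w' * of_int A') (latt (z b))"
    by (simp add: inv_latt_def smul_smul cnj_image_smul)
  hence "latt (z b) = smul (inverse (cnj w' * of_int A')) (smul (cnj w * of_int A) (latt (z a)))"
    using assms(5,7) by (simp add: smul_smul mult_ac)
  hence "smul (inverse (cnj w' * of_int A') * (cnj w * of_int A)) (latt (z a)) = latt (z b)"
    by (simp add: smul_smul)
  moreover have "inverse (cnj w' * of_int A') * (cnj w * of_int A) \<noteq> 0" using assms by simp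
  ultimately show False
    using assms(1)[unfolded CM_reps_def, THEN conjunct2, THEN conjunct1, rule_format,
        OF assms(2,3) ab]
    unfolding smul_def by blast
qed

section \<open>Powers of an ideal and inverse classes\<close>

fun idl_pow :: "int \<Rightarrow> complex set \<Rightarrow> nat \<Rightarrow> complex set" where
  "idl_pow D I 0 = OK D"
| "idl_pow D I (Suc n) = idl_mult I (idl_pow D I n)"

lemma integral_ideal_idl_pow:
  "fund_disc D \<Longrightarrow> integral_ideal D I \<Longrightarrow> integral_ideal D (idl_pow D I n)"
  by (induction n) (simp_all add: integral_ideal_OK integral_ideal_idl_mult)

lemma idl_pow_add:
  assumes "fund_disc D" "integral_ideal D I"
  shows "idl_pow D I (m + n) = idl_mult (idl_pow D I m) (idl_pow D I n)"
proof (induction m)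
  case 0
  show ?case using idl_mult_OK_left integral_idealD(1)[OF integral_ideal_idl_pow[OF assms]] by simp
next
  case (Suc m)
  thus ?case by (simp add: idl_mult_assoc)
qed

lemma coprime_idl_pow:
  assumes "fund_disc D" "integral_ideal D I" "integral_ideal D cf" "coprime_idl D I cf"
  shows "coprime_idl D (idl_pow D I n) cf"
proof (induction n)
  case 0
  have "0 \<in> cf" using add_subgroupD(1)[OF OK_moduleD(1)[OF integral_idealD(1)[OF assms(3)]]] .
  hence "\<exists>x\<in>OK D. \<exists>y\<in>cf. x + y = 1"
    using OK_ring(1)[OF assms(1)] by (intro bexI[of _ 1] bexI[of _ 0]) simp_all
  thus ?case using coprime_idl_iff'[OF assms(1) integral_ideal_OK[OF assms(1)] assms(3)] by simp
next
  case (Suc n)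
  show ?case unfolding idl_pow.simps
    by (rule coprime_idl_mult[OF assms(1,2) integral_ideal_idl_pow[OF assms(1,2)] assms(3,4) Suc])
qed

text \<open>Among the powers of an ideal two lie in the same of the finitely many classes, so some
  power is principal, and a lower power represents the inverse class.\<close>
lemma inverse_class_coprime:
  assumes "fund_disc D" "CM_reps D h z" "\<forall>a\<in>{1..h}. prim_eq (z a) (A a) (B a) (C a)"
    "integral_ideal D I" "integral_ideal D cf" "coprime_idl D I cf"
  obtains J \<alpha> where "integral_ideal D J" "coprime_idl D J cf" "\<alpha> \<noteq> 0"
    "idl_mult I J = smul \<alpha> (OK D)"
proof -
  note pow = integral_ideal_idl_pow[OF assms(1,4)]
  have "\<exists>a w. a \<in> {1..h} \<and> w \<noteq> 0 \<and> idl_pow D I n = smul w (inv_latt (A a) (z a))" for n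
    by (rule CM_reps_cover[OF assms(1-3) pow[of n]]) blast
  then obtain a w where aw: "\<And>n. a n \<in> {1..h}" "\<And>n. w n \<noteq> 0"
    "\<And>n. idl_pow D I n = smul (w n) (inv_latt (A (a n)) (z (a n)))" by metis
  have "\<not> inj (a :: nat \<Rightarrow> nat)"
  proof
    assume "inj a"
    hence "infinite (range a)" by (rule range_inj_infinite)
    moreover have "range a \<subseteq> {1..h}" using aw(1) by blast
    ultimately show False using finite_subset by blast
  qed
  then obtain m n where "a m = a n" "m \<noteq> n" unfolding inj_def by blast
  then obtain m n where "a m = a n" "m < n" by (metis linorder_neqE_nat)
  then obtain k where k: "n = m + Suc k" using less_iff_Suc_add[of m n] by auto
  let ?M = "idl_pow D I m"
  define s where "s = w n * inverse (w m)"
  have s: "s \<noteq> 0" using aw(2) by (simp add: s_def)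
  have "idl_pow D I n = smul s ?M"
    using aw(2) by (simp add: aw(3)[of n] aw(3)[of m] \<open>a m = a n\<close> smul_smul s_def mult.assoc)
  hence eq: "idl_mult ?M (idl_pow D I (Suc k)) = smul s ?M"
    unfolding k idl_pow_add[OF assms(1,4)] .
  \<comment> \<open>Cancelling the power with exponent \<open>m\<close> shows that the power with
    exponent \<open>Suc k\<close> is principal; the power with exponent \<open>k\<close> serves as
    \<open>J\<close>.\<close>
  obtain M' where M': "OK_module D M'" "idl_mult ?M M' = OK D"
    using integral_ideal_inverse[OF assms(1) pow[of m]] by blast
  have "idl_pow D I (Suc k) = idl_mult (OK D) (idl_pow D I (Suc k))"
    by (rule idl_mult_OK_left[OF integral_idealD(1)[OF pow], symmetric])
  also have "\<dots> = idl_mult M' (idl_mult ?M (idl_pow D I (Suc k)))"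
    by (simp only: idl_mult_assoc[symmetric] idl_mult_comm[of M' ?M] M'(2))
  also have "\<dots> = smul s (OK D)"
    by (simp only: eq idl_mult_smul_right idl_mult_comm[of M' ?M] M'(2))
  finally have "idl_mult I (idl_pow D I k) = smul s (OK D)" by simp
  thus ?thesis by (rule that[OF pow coprime_idl_pow[OF assms(1,4,5,6)] s])
qed

section \<open>The character on ideals in a class\<close>

text \<open>The cofactor \<open>L\<close> lies in \<open>OK D\<close>, and \<open>cf\<close> absorbs
  it.\<close>

lemma cbar_subset:
  assumes "fund_disc D" "integral_ideal D cf" "idl_dvd D cf (cbar D f)"
  shows "cbar D f \<subseteq> cf"
proof -
  obtain L where L: "integral_ideal D L" "cbar D f = idl_mult cf L"
    using assms(3) by (auto simp: idl_dvd_def)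
  have "idl_mult cf L \<subseteq> idl_mult cf (OK D)"
    using integral_idealD(2)[OF L(1)] by (intro idl_mult_mono) auto
  thus ?thesis unfolding L(2) idl_mult_OK_right[OF integral_idealD(1)[OF assms(2)]] .
qed

text \<open>\<open>v\<close> is \<open>f * sqrtD D\<close> times some \<open>u \<in> latt z\<close>,
  and \<open>u\<close> times \<open>inv_latt A z\<close> lies in \<open>OK D\<close> because the two
  lattices are inverse.\<close>

lemma smul_inv_latt_subset_cbar:
  assumes "cm_point D z A B C" "v \<in> smul (of_nat f * sqrtD D) (latt z)"
  shows "smul v (inv_latt A z) \<subseteq> cbar D f"
proof
  fix x assume "x \<in> smul v (inv_latt A z)"
  then obtain u t where "u \<in> latt z" "t \<in> inv_latt A z" "x = of_nat f * sqrtD D * u * t"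
    using assms(2) by (auto simp: smul_def)
  moreover from this have "u * t \<in> OK D"
    unfolding latt_inv_latt[OF assms(1), symmetric] by (intro idl_mult_mem)
  ultimately show "x \<in> cbar D f" unfolding cbar_eq_smul
    using smul_memI[of "u * t" "OK D" "of_nat f * sqrtD D"] by (simp add: mult.assoc)
qed

text \<open>If \<open>w t + y = 1\<close> with \<open>y \<in> cf\<close>, then
  \<open>w' t + (y - (w' - w) t) = 1\<close>, and \<open>(w' - w) t\<close> lies in
  \<open>cbar D f\<close>, hence in \<open>cf\<close>.\<close>

lemma coprime_shift:
  assumes "fund_disc D" "cm_point D z A B C" "integral_ideal D cf" "cbar D f \<subseteq> cf"
    "w \<in> latt z" "w' \<in> latt z" "w' - w \<in> smul (of_nat f * sqrtD D) (latt z)"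
    "coprime_idl D (smul w (inv_latt A z)) cf"
  shows "coprime_idl D (smul w' (inv_latt A z)) cf"
proof -
  let ?N = "inv_latt A z"
  have mod: "OK_module D (smul v ?N)" "smul v ?N \<subseteq> OK D" if "v \<in> latt z" for v
  proof -
    show "OK_module D (smul v ?N)" by (rule OK_module_smul[OF OK_module_inv_latt[OF assms(2)]])
    show "smul v ?N \<subseteq> OK D"
      unfolding latt_inv_latt[OF assms(2), symmetric] smul_def using idl_mult_mem[OF that] by blast
  qed
  note cf = integral_idealD[OF assms(3)]
  note iff = coprime_idl_iff[OF assms(1) mod cf(1,2)]
  obtain x y where xy: "x \<in> smul w ?N" "y \<in> cf" "x + y = 1"
    using assms(8) unfolding iff[OF assms(5) assms(5)] by blast
  then obtain t where t: "t \<in> ?N" "x = w * t" by (auto simp: smul_def)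
  have "(w' - w) * t \<in> cf"
    using smul_memI[OF t(1), of "w' - w"] smul_inv_latt_subset_cbar[OF assms(2,7)] assms(4) by blast
  hence "y - (w' - w) * t \<in> cf" by (intro add_subgroupD(4)[OF OK_moduleD(1)[OF cf(1)]] xy)
  moreover have "w' * t \<in> smul w' ?N" using t by (intro smul_memI)
  moreover have "w' * t + (y - (w' - w) * t) = 1" using xy t by (simp add: algebra_simps)
  ultimately show ?thesis unfolding iff[OF assms(6) assms(6)] by blast
qed

text \<open>Both ideals are multiplied by some \<open>J\<close> prime to \<open>cf\<close> that
  makes the first one principal. The products are generated by \<open>\<alpha>\<close> and
  \<open>\<alpha>' = \<alpha> w' / w\<close>, which are congruent modulo \<open>cf\<close>. So
  \<open>\<psi>\<close> agrees on them, and the two values of \<open>\<phi>\<close> are in the ratio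
  of the generators.\<close>

lemma hecke_char_ratio:
  assumes "fund_disc D" "CM_reps D h zz" "\<forall>a\<in>{1..h}. prim_eq (zz a) (AA a) (BB a) (CC a)"
    "hecke_char D cf \<phi>" "cbar D f \<subseteq> cf" "cm_point D z A B C"
    "w \<in> latt z" "w' \<in> latt z" "w \<noteq> 0" "w' \<noteq> 0"
    "w' - w \<in> smul (of_nat f * sqrtD D) (latt z)"
    "coprime_idl D (smul w (inv_latt A z)) cf"
  shows "\<phi> (smul w' (inv_latt A z)) * w = \<phi> (smul w (inv_latt A z)) * w'"
proof -
  let ?N = "inv_latt A z"
  let ?I = "smul w ?N" and ?I' = "smul w' ?N"
  have cf: "integral_ideal D cf" using assms(4) by (simp add: hecke_char_def)
  obtain \<psi> where \<psi>: "\<And>\<alpha> \<beta>. \<alpha> \<in> OK D \<Longrightarrow> \<beta> \<in> OK D \<Longrightarrow> \<alpha> - \<beta> \<in> cf \<Longrightarrow> \<psi> \<alpha> = \<psi> \<beta>"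
    "\<And>\<alpha>. \<alpha> \<in> OK D \<Longrightarrow> coprime_idl D (principal D \<alpha>) cf \<Longrightarrow> \<psi> \<alpha> \<noteq> 0"
    "\<And>\<alpha>. \<alpha> \<in> OK D \<Longrightarrow> \<alpha> \<noteq> 0 \<Longrightarrow> coprime_idl D (principal D \<alpha>) cf \<Longrightarrow> \<phi> (principal D \<alpha>) = \<alpha> * \<psi> \<alpha>"
    using assms(4)[unfolded hecke_char_def, THEN conjunct2, THEN conjunct2, THEN conjunct2, THEN conjunct1]
    by blast
  have mult: "\<phi> (idl_mult I J) = \<phi> I * \<phi> J"
    if "integral_ideal D I" "integral_ideal D J" "coprime_idl D I cf" "coprime_idl D J cf" for I J
    using assms(4)[unfolded hecke_char_def, THEN conjunct2, THEN conjunct1] that by blast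
  have nz: "\<phi> I \<noteq> 0" if "integral_ideal D I" "coprime_idl D I cf" for I
    using assms(4)[unfolded hecke_char_def, THEN conjunct2, THEN conjunct2, THEN conjunct1] that by blast
  have I: "integral_ideal D ?I" "integral_ideal D ?I'"
    using integral_ideal_smul_inv_latt[OF assms(6,9)] integral_ideal_smul_inv_latt[OF assms(6,10)]
      assms(7,8) by simp_all
  have cop': "coprime_idl D ?I' cf"
    using coprime_shift[OF assms(1,6) cf assms(5,7,8,11,12)] .
  obtain J \<alpha> where J: "integral_ideal D J" "coprime_idl D J cf" "\<alpha> \<noteq> 0"
    "idl_mult ?I J = smul \<alpha> (OK D)"
    using inverse_class_coprime[OF assms(1-3) I(1) cf assms(12)] by blast
  define \<alpha>' where "\<alpha>' = \<alpha> * (w' / w)"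
  \<comment> \<open>In general \<open>N J\<close> is only a fractional ideal; both products are
    multiples of it, which yields the generator of the second from that of the first.\<close>
  have NJ: "idl_mult ?N J = smul (\<alpha> / w) (OK D)"
  proof -
    have "smul w (idl_mult ?N J) = smul \<alpha> (OK D)" using J(4) by (simp add: idl_mult_smul_left)
    hence "idl_mult ?N J = smul (inverse w) (smul \<alpha> (OK D))" using smul_eq_iff[OF assms(9)] by blast
    thus ?thesis by (simp add: smul_smul divide_inverse mult.commute)
  qed
  have I'J: "idl_mult ?I' J = smul \<alpha>' (OK D)"
    unfolding idl_mult_smul_left NJ smul_smul \<alpha>'_def by (simp add: mult_ac)
  have mem: "\<beta> \<in> OK D" if "integral_ideal D (smul \<beta> (OK D))" for \<beta>
    using integral_idealD(2)[OF that] smul_memI[OF of_int_mem_OK[of 1 D], of \<beta>] by auto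
  have IJ: "integral_ideal D (smul \<alpha> (OK D))" "integral_ideal D (smul \<alpha>' (OK D))"
    unfolding J(4)[symmetric] I'J[symmetric]
    by (rule integral_ideal_idl_mult[OF assms(1) I(1) J(1)], rule integral_ideal_idl_mult[OF assms(1) I(2) J(1)])
  note \<alpha> = mem[OF IJ(1)] and \<alpha>' = mem[OF IJ(2)]
  have \<alpha>'0: "\<alpha>' \<noteq> 0" using J(3) assms(9,10) by (simp add: \<alpha>'_def)
  have cop: "coprime_idl D (principal D \<alpha>) cf" "coprime_idl D (principal D \<alpha>') cf"
    unfolding principal_eq_smul J(4)[symmetric] I'J[symmetric]
    by (rule coprime_idl_mult[OF assms(1) I(1) J(1) cf assms(12) J(2)],
        rule coprime_idl_mult[OF assms(1) I(2) J(1) cf cop' J(2)])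
  \<comment> \<open>Here \<open>\<alpha>' - \<alpha>\<close> is
    \<open>(w' - w) \<alpha> / w\<close>, where \<open>w' - w\<close> is \<open>f * sqrtD D\<close>
    times \<open>v \<in> latt z\<close>; and \<open>v \<alpha> / w\<close> lies in
    \<open>latt z\<close> times \<open>N J\<close>, which is \<open>J\<close>.\<close>
  have "\<alpha>' - \<alpha> \<in> cf"
  proof -
    obtain v where v: "v \<in> latt z" "w' - w = of_nat f * sqrtD D * v"
      using assms(11) by (auto simp: smul_def)
    have "\<alpha> / w * 1 \<in> idl_mult ?N J" unfolding NJ by (intro smul_memI OK_ring(1) assms(1))
    hence "v * (\<alpha> / w) \<in> idl_mult (latt z) (idl_mult ?N J)" using v(1) by (intro idl_mult_mem) simp_all
    also have "\<dots> = J"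
      unfolding idl_mult_assoc[symmetric] latt_inv_latt[OF assms(6)]
      by (rule idl_mult_OK_left[OF integral_idealD(1)[OF J(1)]])
    finally have "v * (\<alpha> / w) \<in> OK D" using integral_idealD(2)[OF J(1)] by blast
    hence "of_nat f * sqrtD D * (v * (\<alpha> / w)) \<in> cf"
      using assms(5) smul_memI[of _ "OK D" "of_nat f * sqrtD D"] unfolding cbar_eq_smul by blast
    moreover have "\<alpha>' - \<alpha> = (w' - w) * (\<alpha> / w)" using assms(9) by (simp add: \<alpha>'_def field_simps)
    ultimately show ?thesis unfolding v(2) by (simp add: mult.assoc)
  qed
  hence \<psi>eq: "\<psi> \<alpha>' = \<psi> \<alpha>" by (rule \<psi>(1)[OF \<alpha>' \<alpha>])
  have "\<phi> ?I * \<phi> J = \<alpha> * \<psi> \<alpha>"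
    using mult[OF I(1) J(1) assms(12) J(2)] \<psi>(3)[OF \<alpha> J(3) cop(1)] J(4)
    by (simp add: principal_eq_smul)
  moreover have "\<phi> ?I' * \<phi> J = \<alpha>' * \<psi> \<alpha>"
    using mult[OF I(2) J(1) cop' J(2)] \<psi>(3)[OF \<alpha>' \<alpha>'0 cop(2)] I'J \<psi>eq
    by (simp add: principal_eq_smul)
  moreover have "\<alpha>' * w = \<alpha> * w'" using assms(9) by (simp add: \<alpha>'_def)
  ultimately have "\<phi> ?I' * w * \<phi> J = \<phi> ?I * w' * \<phi> J"
    by (metis mult.assoc mult.commute)
  thus ?thesis using nz[OF J(1,2)] by simp
qed

section \<open>Annihilators\<close>

text \<open>For \<open>q = w N + \<gamma> OK\<close>, a number \<open>x\<close> in
  \<open>OK D\<close> annihilates \<open>w\<close> iff \<open>x w N \<subseteq> \<gamma> OK\<close>,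
  that is, iff \<open>x q \<subseteq> \<gamma> OK\<close>, because \<open>x \<gamma>\<close> lies
  there anyway. So the annihilator is \<open>\<gamma>\<close> times the inverse of
  \<open>q\<close>.\<close>

lemma annihilator_times_gcd:
  assumes "fund_disc D" "f > 0" "cm_point D z A B C" "integral_ideal D cf" "cbar D f \<subseteq> cf"
    "w \<in> latt z" "coprime_idl D (smul w (inv_latt A z)) cf"
  shows "\<exists>q. integral_ideal D q \<and> idl_dvd D q (cbar D f) \<and> coprime_idl D q cf \<and>
    idl_mult {\<alpha> \<in> OK D. \<alpha> * w \<in> (\<lambda>v. of_nat f * sqrtD D * v) ` latt z} q = cbar D f"
proof -
  let ?N = "inv_latt A z"
  define \<gamma> where "\<gamma> = of_nat f * sqrtD D"
  define q where "q = idl_sum (smul w ?N) (cbar D f)"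
  define L where "L = {\<alpha> \<in> OK D. \<alpha> * w \<in> smul \<gamma> (latt z)}"
  have D: "D < 0" using fund_disc_neg assms(1) .
  have \<gamma>0: "\<gamma> \<noteq> 0" using assms(2) sqrtD_nonzero[OF D] by (simp add: \<gamma>_def)
  have c: "cbar D f = smul \<gamma> (OK D)" by (simp add: cbar_eq_smul \<gamma>_def)
  have sqrtD: "sqrtD D = of_int (- D) + of_int 2 * om D"
    by (simp add: om_def add_divide_distrib distrib_left)
  have "sqrtD D \<in> OK D" unfolding OK_eq_latt by (subst sqrtD) (rule latt_memI)
  moreover have "(of_nat f :: complex) \<in> OK D" using of_int_mem_OK[of "int f" D] by simp
  ultimately have \<gamma>OK: "\<gamma> \<in> OK D" unfolding \<gamma>_def using OK_ring(2)[OF assms(1)] by blast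
  have wN: "OK_module D (smul w ?N)" "smul w ?N \<subseteq> OK D"
  proof -
    show "OK_module D (smul w ?N)" by (rule OK_module_smul[OF OK_module_inv_latt[OF assms(3)]])
    show "smul w ?N \<subseteq> OK D"
      unfolding latt_inv_latt[OF assms(3), symmetric] smul_def using idl_mult_mem[OF assms(6)] by blast
  qed
  have cm: "OK_module D (cbar D f)" "cbar D f \<subseteq> OK D"
    unfolding c using OK_module_smul[OF OK_module_OK[OF assms(1)]] OK_ring(2)[OF assms(1) \<gamma>OK]
    by (auto simp: smul_def)
  have cfm: "OK_module D cf" "cf \<subseteq> OK D" using integral_idealD[OF assms(4)] by simp_all
  have sub1: "smul w ?N \<subseteq> q"
  proof
    fix x assume x: "x \<in> smul w ?N"
    have "x = x + 0" by simp
    thus "x \<in> q" unfolding q_def idl_sum_def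
      using x add_subgroupD(1)[OF OK_moduleD(1)[OF cm(1)]] by blast
  qed
  have sub2: "cbar D f \<subseteq> q"
  proof
    fix x assume x: "x \<in> cbar D f"
    have "x = 0 + x" by simp
    thus "x \<in> q" unfolding q_def idl_sum_def
      using x add_subgroupD(1)[OF OK_moduleD(1)[OF wN(1)]] by blast
  qed
  have \<gamma>q: "\<gamma> \<in> q" using sub2 smul_memI[OF OK_ring(1)[OF assms(1)], of \<gamma>] unfolding c by auto
  have qmod: "OK_module D q"
    unfolding OK_module_def
  proof (intro conjI ballI add_subgroupI)
    show "0 \<in> q" using sub1 add_subgroupD(1)[OF OK_moduleD(1)[OF wN(1)]] by blast
    fix u assume u: "u \<in> q"
    then obtain x y where x: "x \<in> smul w ?N" and y: "y \<in> cbar D f" and uxy: "u = x + y"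
      unfolding q_def idl_sum_def by blast
    have "- u = - x + - y" using uxy by simp
    thus "- u \<in> q" unfolding q_def idl_sum_def
      using add_subgroupD(3)[OF OK_moduleD(1)[OF wN(1)] x] add_subgroupD(3)[OF OK_moduleD(1)[OF cm(1)] y]
      by blast
    show "r * u \<in> q" if "r \<in> OK D" for r
    proof -
      have "r * u = r * x + r * y" using uxy by (simp add: distrib_left)
      thus ?thesis unfolding q_def idl_sum_def
        using OK_moduleD(2)[OF wN(1) that x] OK_moduleD(2)[OF cm(1) that y] by blast
    qed
    fix v assume "v \<in> q"
    then obtain x' y' where x': "x' \<in> smul w ?N" and y': "y' \<in> cbar D f" and vxy: "v = x' + y'"
      unfolding q_def idl_sum_def by blast
    have "u + v = (x + x') + (y + y')" using uxy vxy by simp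
    thus "u + v \<in> q" unfolding q_def idl_sum_def
      using add_subgroupD(2)[OF OK_moduleD(1)[OF wN(1)] x x'] add_subgroupD(2)[OF OK_moduleD(1)[OF cm(1)] y y']
      by blast
  qed
  have "q \<subseteq> OK D" unfolding q_def idl_sum_def
    using wN(2) cm(2) add_subgroupD(2)[OF OK_ring(3)[OF assms(1)]] by blast
  hence q: "integral_ideal D q" unfolding integral_ideal_iff using qmod \<gamma>q \<gamma>0 by blast
  \<comment> \<open>\<open>q\<close> contains \<open>w N\<close>, which is already prime to
    \<open>cf\<close>.\<close>
  have cop: "coprime_idl D q cf"
    using assms(7) sub1 unfolding coprime_idl_iff[OF assms(1) qmod \<open>q \<subseteq> OK D\<close> cfm]
      coprime_idl_iff[OF assms(1) wN cfm] by blast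
  obtain q' where q': "OK_module D q'" "idl_mult q q' = OK D"
    using integral_ideal_inverse[OF assms(1) q] by blast
  have Leq: "L = smul \<gamma> q'"
  proof
    show "L \<subseteq> smul \<gamma> q'"
    proof
      fix x assume x: "x \<in> L"
      hence xO: "x \<in> OK D" and "x * w \<in> smul \<gamma> (latt z)" by (auto simp: L_def)
      hence xw: "smul (x * w) ?N \<subseteq> cbar D f"
        unfolding \<gamma>_def by (intro smul_inv_latt_subset_cbar[OF assms(3)])
      have "smul x q \<subseteq> smul \<gamma> (OK D)"
      proof
        fix u assume "u \<in> smul x q"
        then obtain t y where t: "t \<in> ?N" and y: "y \<in> cbar D f" and u: "u = x * (w * t + y)"
          unfolding q_def idl_sum_def smul_def by blast
        have "u = (x * w) * t + x * y" using u by (simp add: algebra_simps)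
        moreover have "(x * w) * t \<in> cbar D f" using xw smul_memI[OF t, of "x * w"] by blast
        moreover have "x * y \<in> cbar D f" using OK_moduleD(2)[OF cm(1) xO y] .
        ultimately show "u \<in> smul \<gamma> (OK D)"
          using add_subgroupD(2)[OF OK_moduleD(1)[OF cm(1)]] c by simp
      qed
      hence "idl_mult (smul x q) q' \<subseteq> idl_mult (smul \<gamma> (OK D)) q'" by (intro idl_mult_mono) auto
      hence "smul x (OK D) \<subseteq> smul \<gamma> q'"
        unfolding idl_mult_smul_left q'(2) idl_mult_OK_left[OF q'(1)] .
      thus "x \<in> smul \<gamma> q'" using smul_memI[OF OK_ring(1)[OF assms(1)], of x] by auto
    qed
    show "smul \<gamma> q' \<subseteq> L"
    proof
      fix x assume "x \<in> smul \<gamma> q'"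
      then obtain v where v: "v \<in> q'" "x = \<gamma> * v" by (auto simp: smul_def)
      \<comment> \<open>Used twice: \<open>w N \<subseteq> q\<close> leads to
        \<open>w v \<in> latt z\<close>, and \<open>\<gamma> \<in> q\<close> gives
        \<open>x \<in> OK D\<close>.\<close>
      have vq: "u * v \<in> OK D" if "u \<in> q" for u
        unfolding q'(2)[symmetric] by (intro idl_mult_mem that v)
      have "smul (w * v) ?N \<subseteq> OK D"
      proof
        fix u assume "u \<in> smul (w * v) ?N"
        then obtain t where "t \<in> ?N" "u = (w * t) * v" by (auto simp: smul_def)
        thus "u \<in> OK D" using vq[of "w * t"] sub1 smul_memI[of t ?N w] by blast
      qed
      hence "idl_mult (smul (w * v) ?N) (latt z) \<subseteq> idl_mult (OK D) (latt z)"
        by (intro idl_mult_mono) auto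
      hence "smul (w * v) (OK D) \<subseteq> latt z"
        unfolding idl_mult_smul_left idl_mult_comm[of ?N] latt_inv_latt[OF assms(3)]
          idl_mult_OK_left[OF OK_module_latt[OF assms(3)]] .
      hence "w * v \<in> latt z" using smul_memI[OF OK_ring(1)[OF assms(1)], of "w * v"] by auto
      hence "\<gamma> * (w * v) \<in> smul \<gamma> (latt z)" by (rule smul_memI)
      hence "x * w \<in> smul \<gamma> (latt z)" by (simp add: v(2) mult_ac)
      moreover have "x \<in> OK D" using vq[OF \<gamma>q] v(2) by simp
      ultimately show "x \<in> L" by (simp add: L_def)
    qed
  qed
  have Lq: "idl_mult L q = cbar D f"
    unfolding Leq idl_mult_smul_left idl_mult_comm[of q'] q'(2) c ..
  have "integral_ideal D L" unfolding integral_ideal_iff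
  proof (intro conjI)
    show "OK_module D L" unfolding Leq by (rule OK_module_smul[OF q'(1)])
    show "L \<subseteq> OK D" by (auto simp: L_def)
    have "\<gamma> \<in> L" using \<gamma>OK smul_memI[OF assms(6)] by (simp add: L_def)
    thus "L \<noteq> {0}" using \<gamma>0 by blast
  qed
  hence "idl_dvd D q (cbar D f)" unfolding idl_dvd_def using Lq idl_mult_comm[of q L] by blast
  moreover have "L = {\<alpha> \<in> OK D. \<alpha> * w \<in> (\<lambda>v. of_nat f * sqrtD D * v) ` latt z}"
    by (simp add: L_def smul_def \<gamma>_def)
  ultimately show ?thesis using q cop Lq by blast
qed

section \<open>The discriminant group\<close>

text \<open>Agrees with \<open>Omega\<close> once the order of the discriminant group is known to be \<open>f\<^sup>2 * \<bar>D\<bar>\<close>.\<close>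
definition dev :: "int \<Rightarrow> nat \<Rightarrow> complex \<Rightarrow> real \<times> real \<Rightarrow> complex" where
  "dev D f z y = of_nat f * sqrtD D * (of_real (fst y) - of_real (snd y) * z)"

lemma dev_add: "dev D f z (y + y') = dev D f z y + dev D f z y'"
  by (simp add: dev_def algebra_simps)

text \<open>A consequence of \<open>sqrtD D = 2 A z + B\<close> and the equation of
  \<open>z\<close>. It identifies the coordinates of \<open>dev\<close> with respect to 1 and
  \<open>z\<close> with pairings against the basis of the lattice.\<close>

lemma dev_eq_bil:
  assumes "cm_point D z A B C"
  shows "dev D f z y = of_real (bil f A B C y (0, 1)) + of_real (bil f A B C y (1, 0)) * z"
proof -
  note c = cm_pointD[OF assms]
  have s: "sqrtD D = 2 * of_int A * z + of_int B" using prim_eq_root(2)[OF c(1,2)] c(5) by simp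
  have "dev D f z y - (of_real (bil f A B C y (0, 1)) + of_real (bil f A B C y (1, 0)) * z)
     = - 2 * of_nat f * of_real (snd y) * (of_int A * z\<^sup>2 + of_int B * z + of_int C)"
    unfolding dev_def s bil_def by (simp add: algebra_simps power2_eq_square)
  thus ?thesis unfolding c(7) by simp
qed

lemma inj_dev:
  assumes "cm_point D z A B C" "f > 0"
  shows "inj (dev D f z)"
proof (rule injI)
  fix x y assume "dev D f z x = dev D f z y"
  note c = cm_pointD[OF assms(1)]
  have "of_nat f * sqrtD D \<noteq> 0" using assms(2) sqrtD_nonzero[OF c(4)] by simp
  hence "of_real (fst x) - of_real (snd x) * z = of_real (fst y) - of_real (snd y) * z"
    using \<open>dev D f z x = dev D f z y\<close> unfolding dev_def by (simp only: mult_cancel_left) auto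
  hence eqs: "fst x - snd x * Re z = fst y - snd y * Re z" "snd x * Im z = snd y * Im z"
    by (simp_all add: complex_eq_iff)
  hence "snd x = snd y" using c(1) by simp
  thus "x = y" using eqs by (simp add: prod_eq_iff)
qed

lemma surj_dev:
  assumes "cm_point D z A B C" "f > 0"
  shows "surj (dev D f z)"
proof -
  note c = cm_pointD[OF assms(1)]
  have g: "of_nat f * sqrtD D \<noteq> 0" using assms(2) sqrtD_nonzero[OF c(4)] by simp
  have "\<exists>y. u = dev D f z y" for u
  proof -
    define v where "v = u / (of_nat f * sqrtD D)"
    \<comment> \<open>Forced by the imaginary part, to which the first coordinate does not
      contribute.\<close>
    define t where "t = - Im v / Im z"
    have "of_real (Re v + t * Re z) - of_real t * z = v"
      using c(1) by (simp add: complex_eq_iff t_def)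
    hence "dev D f z (Re v + t * Re z, t) = of_nat f * sqrtD D * v" unfolding dev_def by simp
    also have "\<dots> = u" using g by (simp add: v_def)
    finally show ?thesis by blast
  qed
  thus ?thesis unfolding surj_def by blast
qed

text \<open>A vector is dual iff its pairings with the two basis vectors are integers, and by
  \<open>dev_eq_bil\<close> these pairings are the coordinates of its image.\<close>

lemma Lam_dual_iff:
  assumes "cm_point D z A B C"
  shows "y \<in> Lam_dual f A B C \<longleftrightarrow> dev D f z y \<in> latt z"
proof
  assume y: "y \<in> Lam_dual f A B C"
  have "(of_int 1, of_int 0) \<in> Lam" "(of_int 0, of_int 1) \<in> Lam" unfolding Lam_def by blast+
  hence "bil f A B C y (1, 0) \<in> \<int>" "bil f A B C y (0, 1) \<in> \<int>"
    using y unfolding Lam_dual_def by auto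
  then obtain m n where "bil f A B C y (1, 0) = of_int n" "bil f A B C y (0, 1) = of_int m"
    by (auto elim!: Ints_cases)
  thus "dev D f z y \<in> latt z" using dev_eq_bil[OF assms, of f y] latt_memI[of m n z] by simp
next
  assume "dev D f z y \<in> latt z"
  then obtain m n where mn: "dev D f z y = of_int m + of_int n * z" by (rule lattE)
  note c = cm_pointD[OF assms]
  have eq: "complex_of_real (bil f A B C y (0, 1)) + of_real (bil f A B C y (1, 0)) * z = of_int m + of_int n * z"
    using mn dev_eq_bil[OF assms, of f y] by simp
  from arg_cong[OF eq, of Im] have n: "bil f A B C y (1, 0) = of_int n" using c(1) by simp
  with arg_cong[OF eq, of Re] have m: "bil f A B C y (0, 1) = of_int m" by simp
  show "y \<in> Lam_dual f A B C" unfolding Lam_dual_def mem_Collect_eq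
  proof
    fix x assume "x \<in> Lam"
    then obtain k l where x: "x = (of_int k, of_int l)" by (auto simp: Lam_def)
    have "bil f A B C y x = of_int k * bil f A B C y (1, 0) + of_int l * bil f A B C y (0, 1)"
      by (simp add: bil_def x algebra_simps)
    thus "bil f A B C y x \<in> \<int>" by (simp add: m n)
  qed
qed

lemma dev_Lam: "dev D f z ` Lam = smul (of_nat f * sqrtD D) (latt z)"
proof
  show "dev D f z ` Lam \<subseteq> smul (of_nat f * sqrtD D) (latt z)"
  proof
    fix u assume "u \<in> dev D f z ` Lam"
    then obtain m n where "u = dev D f z (of_int m, of_int n)" by (auto simp: Lam_def)
    hence "u = of_nat f * sqrtD D * (of_int m + of_int (- n) * z)" by (simp add: dev_def)
    thus "u \<in> smul (of_nat f * sqrtD D) (latt z)" by (simp only: smul_memI[OF latt_memI])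
  qed
  show "smul (of_nat f * sqrtD D) (latt z) \<subseteq> dev D f z ` Lam"
  proof
    fix u assume "u \<in> smul (of_nat f * sqrtD D) (latt z)"
    then obtain v where v: "v \<in> latt z" "u = of_nat f * sqrtD D * v" by (auto simp: smul_def)
    from v(1) obtain m n where "v = of_int m + of_int n * z" by (rule lattE)
    hence "u = dev D f z (of_int m, of_int (- n))" by (simp add: dev_def v(2))
    moreover have "(of_int m, of_int (- n)) \<in> Lam" unfolding Lam_def by blast
    ultimately show "u \<in> dev D f z ` Lam" by blast
  qed
qed

section \<open>Cosets and the order of the discriminant group\<close>

lemma coset_eq_image: "coset y = (\<lambda>x. y + x) ` Lam"
  unfolding coset_def plus_prod_def by blast

lemma coset_eqI:
  assumes "y' \<in> coset y"
  shows "coset y' = coset y"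
proof -
  have Lam: "x + x' \<in> Lam" "x - x' \<in> Lam" if "x \<in> Lam" "x' \<in> Lam" for x x'
    using that unfolding Lam_def by (auto simp flip: of_int_add of_int_diff)
  obtain l where l: "l \<in> Lam" "y' = y + l" using assms unfolding coset_eq_image by blast
  show ?thesis
  proof
    show "coset y' \<subseteq> coset y"
    proof
      fix u assume "u \<in> coset y'"
      then obtain x where "x \<in> Lam" "u = y' + x" unfolding coset_eq_image by blast
      hence "u = y + (l + x)" "l + x \<in> Lam" using l Lam(1) by (simp_all add: add.assoc)
      thus "u \<in> coset y" unfolding coset_eq_image by blast
    qed
    show "coset y \<subseteq> coset y'"
    proof
      fix u assume "u \<in> coset y"
      then obtain x where "x \<in> Lam" "u = y + x" unfolding coset_eq_image by blast
      hence "u = y' + (x - l)" "x - l \<in> Lam" using l Lam(2) by simp_all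
      thus "u \<in> coset y'" unfolding coset_eq_image by blast
    qed
  qed
qed

lemma self_mem_coset: "y \<in> coset y"
proof -
  have "(of_int 0, of_int 0) \<in> Lam" unfolding Lam_def by blast
  hence "y + (0, 0) \<in> coset y" unfolding coset_eq_image by simp
  thus ?thesis by (cases y) simp
qed

lemma dev_coset:
  assumes "y' \<in> coset y"
  shows "dev D f z y' - dev D f z y \<in> smul (of_nat f * sqrtD D) (latt z)"
proof -
  obtain x where x: "x \<in> Lam" "y' = y + x" using assms unfolding coset_eq_image by blast
  thus ?thesis unfolding dev_Lam[symmetric] by (simp add: dev_add)
qed

lemma cm_point_smul_latt_subset:
  assumes "fund_disc D" "cm_point D z A B C"
  shows "smul (of_nat f * sqrtD D) (latt z) \<subseteq> latt z"
proof
  fix u assume "u \<in> smul (of_nat f * sqrtD D) (latt z)"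
  then obtain v where v: "v \<in> latt z" "u = of_nat f * sqrtD D * v" by (auto simp: smul_def)
  have sqrtD: "sqrtD D = of_int (- D) + of_int 2 * om D"
    by (simp add: om_def add_divide_distrib distrib_left)
  have "sqrtD D \<in> OK D" unfolding OK_eq_latt by (subst sqrtD) (rule latt_memI)
  hence "sqrtD D * v \<in> latt z" by (rule OK_moduleD(2)[OF OK_module_latt[OF assms(2)] _ v(1)])
  from add_subgroup_of_int_mult[OF add_subgroup_latt this, of "int f"]
  show "u \<in> latt z" by (simp add: v(2) mult.assoc)
qed

lemma coset_subset_Lam_dual:
  assumes "fund_disc D" "cm_point D z A B C" "y \<in> Lam_dual f A B C"
  shows "coset y \<subseteq> Lam_dual f A B C"
proof
  fix x assume "x \<in> coset y"
  hence "dev D f z x - dev D f z y \<in> latt z"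
    using dev_coset cm_point_smul_latt_subset[OF assms(1,2)] by blast
  moreover have "dev D f z y \<in> latt z" using assms(3) Lam_dual_iff[OF assms(2)] by blast
  ultimately have "dev D f z x - dev D f z y + dev D f z y \<in> latt z"
    by (rule add_subgroupD(2)[OF add_subgroup_latt])
  thus "x \<in> Lam_dual f A B C" using Lam_dual_iff[OF assms(2)] by simp
qed

text \<open>\<open>dev\<close> carries the group bijectively onto the cosets of
  \<open>\<gamma> latt z\<close> in \<open>latt z\<close>; the index is the quotient of areas, which
  is the squared absolute value of \<open>\<gamma>\<close>.\<close>

lemma card_disc_grp:
  assumes "fund_disc D" "cm_point D z A B C" "f > 0"
  shows "finite (disc_grp f A B C)" "real (card (disc_grp f A B C)) = (of_nat f)\<^sup>2 * of_int (- D)"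
proof -
  note c = cm_pointD[OF assms(2)]
  define \<gamma> where "\<gamma> = of_nat f * sqrtD D"
  define M where "M = smul \<gamma> (latt z)"
  have \<gamma>2: "\<gamma> * \<gamma> = - of_int (int f * int f * (- D))"
    using sqrtD_square[OF c(4)] by (simp add: \<gamma>_def mult_ac)
  have Im\<gamma>: "cnj \<gamma> * \<gamma> = of_real ((of_nat f)\<^sup>2 * of_int (- D))"
    using sqrtD_square[OF c(4)] by (simp add: \<gamma>_def cnj_sqrtD power2_eq_square mult_ac)
  have pos: "int f * int f * (- D) > 0" using assms(3) c(4) by (intro mult_pos_pos) auto
  \<comment> \<open>The index formula asks for a positive integer multiple of \<open>latt z\<close>
    inside \<open>\<gamma> latt z\<close>; the integer \<open>- \<gamma>^2\<close> serves.\<close>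
  have sub: "smul (of_int (int f * int f * (- D))) (latt z) \<subseteq> M"
  proof
    fix u assume "u \<in> smul (of_int (int f * int f * (- D))) (latt z)"
    then obtain v where v: "v \<in> latt z" "u = of_int (int f * int f * (- D)) * v"
      by (auto simp: smul_def)
    have "of_int (int f * int f * (- D)) = - (\<gamma> * \<gamma>)" unfolding \<gamma>2 by simp
    hence "u = \<gamma> * (- (\<gamma> * v))" unfolding v(2) by (simp add: mult.assoc)
    moreover have "\<gamma> * v \<in> latt z"
      using cm_point_smul_latt_subset[OF assms(1,2), of f] smul_memI[OF v(1)] unfolding \<gamma>_def by blast
    hence "- (\<gamma> * v) \<in> latt z" by (rule add_subgroupD(3)[OF add_subgroup_latt])
    ultimately show "u \<in> M" unfolding M_def by (simp only: smul_memI)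
  qed
  have M: "M = span2 \<gamma> (\<gamma> * z)" unfolding M_def by (rule smul_latt_eq_span2)
  note card = card_cosets_span2[OF c(1) M add_subgroup_smul[OF add_subgroup_latt, of \<gamma> z, folded M_def]
      _ pos sub]
  have Msub: "M \<subseteq> latt z" unfolding M_def \<gamma>_def by (rule cm_point_smul_latt_subset[OF assms(1,2)])
  let ?c = "\<lambda>x. {x + y | y. y \<in> M}"
  have img: "dev D f z ` coset y = ?c (dev D f z y)" for y
  proof -
    have "dev D f z ` coset y = (\<lambda>v. dev D f z y + v) ` (dev D f z ` Lam)"
      unfolding coset_eq_image by (simp add: image_image dev_add)
    thus ?thesis unfolding dev_Lam M_def \<gamma>_def by blast
  qed
  have "(\<lambda>X. dev D f z ` X) ` disc_grp f A B C = ?c ` (dev D f z ` Lam_dual f A B C)"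
    unfolding disc_grp_def by (simp add: image_image img)
  also have "dev D f z ` Lam_dual f A B C = latt z"
  proof
    show "dev D f z ` Lam_dual f A B C \<subseteq> latt z" using Lam_dual_iff[OF assms(2), of _ f] by blast
    show "latt z \<subseteq> dev D f z ` Lam_dual f A B C"
    proof
      fix u assume "u \<in> latt z"
      moreover obtain y where "u = dev D f z y" using surj_dev[OF assms(2,3)] by (rule surjE)
      ultimately show "u \<in> dev D f z ` Lam_dual f A B C" using Lam_dual_iff[OF assms(2)] by blast
    qed
  qed
  finally have eq: "(\<lambda>X. dev D f z ` X) ` disc_grp f A B C = ?c ` latt z" .
  have inj: "inj_on (\<lambda>X. dev D f z ` X) (disc_grp f A B C)"
    using inj_dev[OF assms(2,3)] by (simp add: inj_on_def inj_image_eq_iff)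
  show "finite (disc_grp f A B C)"
    using card(2)[OF Msub] inj unfolding eq[symmetric] by (simp add: finite_image_iff)
  have "card (disc_grp f A B C) = card (?c ` latt z)"
    using card_image[OF inj] unfolding eq by simp
  hence "real (card (disc_grp f A B C)) = \<bar>Im (cnj \<gamma> * (\<gamma> * z))\<bar> / Im z"
    using card(1)[OF Msub] by simp
  also have "cnj \<gamma> * (\<gamma> * z) = of_real ((of_nat f)\<^sup>2 * of_int (- D)) * z"
    unfolding Im\<gamma>[symmetric] by (simp add: mult.assoc)
  also have "\<bar>Im \<dots>\<bar> / Im z = (of_nat f)\<^sup>2 * of_int (- D)"
    using c(1,4) by (simp add: abs_mult)
  finally show "real (card (disc_grp f A B C)) = (of_nat f)\<^sup>2 * of_int (- D)" .
qed

text \<open>By \<open>card_disc_grp\<close>, \<open>\<i>\<close> times the square root of the group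
  order is \<open>f * sqrtD D\<close>; the remaining square roots cancel.\<close>

lemma Omega_eq_dev:
  assumes "fund_disc D" "cm_point D z A B C" "f > 0"
  shows "Omega f A B C z y = dev D f z y"
proof -
  note c = cm_pointD[OF assms(2)]
  have "\<i> * complex_of_real (sqrt (of_nat (card (disc_grp f A B C)))) = of_nat f * sqrtD D"
    unfolding card_disc_grp(2)[OF assms] sqrtD_def real_sqrt_mult by simp
  moreover have "complex_of_real (sqrt (2 * of_int A * of_nat f)) \<noteq> 0" using c(3) assms(3) by simp
  ultimately show ?thesis unfolding Omega_def Omega'_def dev_def by simp
qed

text \<open>\<open>A\<close> times the squared absolute value of \<open>s - t z\<close> is
  \<open>A s^2 + B s t + C t^2\<close>, by norm and trace of \<open>z\<close>. This matches the
  exponents of the lattice theta functions with norms of ideals.\<close>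

lemma bil_eq_norm_dev:
  assumes "cm_point D z A B C"
  shows "of_nat f * of_int \<bar>D\<bar> * bil f A B C y y = 2 * of_int A * (cmod (dev D f z y))\<^sup>2"
proof -
  note c = cm_pointD[OF assms] and nrm = cm_point_norm[OF assms]
  obtain s t where y: "y = (s, t)" by (cases y)
  have "Re (of_int A * (z * cnj z)) = of_int C" "Re (of_int A * z + of_int A * cnj z) = - of_int B"
    unfolding nrm by simp_all
  hence n: "of_int A * ((Re z)\<^sup>2 + (Im z)\<^sup>2) = of_int C" "2 * (of_int A * Re z) = - of_int B"
    by (simp_all add: power2_eq_square mult.commute)
  have "of_int A * (cmod (of_real s - of_real t * z))\<^sup>2
      = of_int A * s\<^sup>2 - s * t * (2 * (of_int A * Re z)) + t\<^sup>2 * (of_int A * ((Re z)\<^sup>2 + (Im z)\<^sup>2))"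
    unfolding cmod_power2 by (simp add: power2_eq_square algebra_simps)
  also have "\<dots> = of_int A * s\<^sup>2 + of_int B * s * t + of_int C * t\<^sup>2"
    unfolding n by (simp add: algebra_simps)
  finally have 1: "bil f A B C y y = 2 * of_nat f * (of_int A * (cmod (of_real s - of_real t * z))\<^sup>2)"
    unfolding bil_def y by (simp add: power2_eq_square algebra_simps)
  have "(cmod (dev D f z y))\<^sup>2 = (of_nat f)\<^sup>2 * of_int (- D) * (cmod (of_real s - of_real t * z))\<^sup>2"
    using c(4) by (simp add: dev_def y sqrtD_def norm_mult power_mult_distrib)
  thus ?thesis unfolding 1 using c(4) by (simp add: power2_eq_square)
qed

section \<open>Absolute convergence\<close>

text \<open>The imaginary part bounds \<open>n\<close>, and then the triangle inequality bounds
  \<open>m\<close>.\<close>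

lemma latt_coords_bound:
  assumes "Im z > 0"
  shows "\<exists>K>0. \<forall>m n. \<bar>of_int m\<bar> + \<bar>of_int n\<bar> \<le> K * cmod (of_int m + of_int n * z)"
proof (intro exI conjI allI)
  let ?K = "1 + (1 + cmod z) / Im z"
  have "(1 + cmod z) / Im z > 0" using assms by (intro divide_pos_pos) (auto simp: add_pos_nonneg)
  thus "?K > 0" by simp
  fix m n :: int
  let ?u = "of_int m + of_int n * z :: complex"
  have "\<bar>of_int n\<bar> * Im z = \<bar>Im ?u\<bar>" using assms by (simp add: abs_mult)
  also have "\<dots> \<le> cmod ?u" by (rule abs_Im_le_cmod)
  finally have n: "\<bar>of_int n\<bar> \<le> cmod ?u / Im z" using assms by (simp add: field_simps)
  have "\<bar>of_int m\<bar> = cmod (?u - of_int n * z)" by simp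
  also have "\<dots> \<le> cmod ?u + cmod (of_int n * z)" by (rule norm_triangle_ineq4)
  also have "cmod (of_int n * z) = \<bar>of_int n\<bar> * cmod z" by (simp add: norm_mult)
  finally have "\<bar>of_int m\<bar> + \<bar>of_int n\<bar> \<le> cmod ?u + \<bar>of_int n\<bar> * (1 + cmod z)"
    by (simp add: algebra_simps)
  also have "\<dots> \<le> cmod ?u + cmod ?u / Im z * (1 + cmod z)"
    by (intro add_left_mono mult_right_mono n) (simp add: add_nonneg_nonneg)
  also have "\<dots> = ?K * cmod ?u" by (simp add: algebra_simps)
  finally show "\<bar>of_int m\<bar> + \<bar>of_int n\<bar> \<le> ?K * cmod ?u" .
qed

lemma finite_latt_bounded:
  assumes "Im z > 0"
  shows "finite {u \<in> latt z. cmod u \<le> R}"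
proof -
  obtain K where K: "K > 0" "\<And>m n. \<bar>of_int m\<bar> + \<bar>of_int n\<bar> \<le> K * cmod (of_int m + of_int n * z)"
    using latt_coords_bound[OF assms] by blast
  define k where "k = \<lceil>K * R\<rceil>"
  have "{u \<in> latt z. cmod u \<le> R} \<subseteq> (\<lambda>(m, n). of_int m + of_int n * z) ` ({-k..k} \<times> {-k..k})"
  proof
    fix u assume u: "u \<in> {u \<in> latt z. cmod u \<le> R}"
    hence "u \<in> latt z" by simp
    then obtain m n where mn: "u = of_int m + of_int n * z" by (rule lattE)
    have "K * cmod u \<le> K * R" using u K(1) by (intro mult_left_mono) auto
    hence "\<bar>real_of_int m\<bar> + \<bar>real_of_int n\<bar> \<le> of_int k"
      using K(2)[of m n] unfolding mn k_def by linarith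
    hence "\<bar>m\<bar> + \<bar>n\<bar> \<le> k" by linarith
    thus "u \<in> (\<lambda>(m, n). of_int m + of_int n * z) ` ({-k..k} \<times> {-k..k})"
      unfolding mn by (intro image_eqI[of _ _ "(m, n)"]) auto
  qed
  thus ?thesis by (rule finite_subset) simp
qed

lemma summable_exp_abs_int:
  assumes "e > 0"
  shows "(\<lambda>m :: int. exp (- e * \<bar>of_int m\<bar>) :: real) summable_on UNIV"
proof -
  let ?f = "\<lambda>m :: int. exp (- e * \<bar>of_int m\<bar>) :: real"
  have "summable (\<lambda>n. exp (- e) ^ n)" using assms by (intro summable_geometric) simp
  hence "(\<lambda>n. exp (- e) ^ n) summable_on UNIV" by (intro norm_summable_imp_summable_on) simp
  hence nat: "(\<lambda>n. exp (- e * real n)) summable_on UNIV"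
    by (simp add: exp_of_nat_mult[symmetric] mult.commute)
  have 1: "?f summable_on range int"
    using nat by (subst summable_on_reindex) (auto simp: o_def)
  have "?f summable_on range (\<lambda>n. - int n)"
    using nat by (subst summable_on_reindex) (auto simp: o_def inj_def)
  \<comment> \<open>Removing the range of \<open>int\<close> keeps 0 from being counted
    twice.\<close>
  hence 2: "?f summable_on (range (\<lambda>n. - int n) - range int)"
    by (rule summable_on_subset) auto
  have "?f summable_on (range int \<union> (range (\<lambda>n. - int n) - range int))"
    by (rule summable_on_Un_disjoint[OF 1 2]) auto
  also have "range int \<union> (range (\<lambda>n. - int n) - range int) = UNIV"
  proof (intro equalityI subsetI UNIV_I)
    fix x :: int
    show "x \<in> range int \<union> (range (\<lambda>n. - int n) - range int)"
      by (cases x rule: int_cases2) auto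
  qed
  finally show ?thesis .
qed

text \<open>With \<open>x = cmod u\<close> one has
  \<open>x exp (- c x^2) <= exp (1 / c - x)\<close>, and \<open>x\<close> dominates a multiple of
  the sum of the absolute coordinates, so a product of two geometric series is a majorant.\<close>

lemma summable_latt_gauss:
  assumes "Im z > 0" "c > 0"
  shows "(\<lambda>u. cmod u * exp (- c * (cmod u)\<^sup>2)) summable_on latt z"
proof -
  obtain K where K: "K > 0" "\<And>m n. \<bar>of_int m\<bar> + \<bar>of_int n\<bar> \<le> K * cmod (of_int m + of_int n * z)"
    using latt_coords_bound[OF assms(1)] by blast
  define e where "e = 1 / K"
  have e: "e > 0" using K by (simp add: e_def)
  let ?a = "\<lambda>m :: int. exp (- e * \<bar>of_int m\<bar>) :: real"
  let ?g = "\<lambda>(m, n). of_int m + of_int n * z"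
  obtain S where S: "(?a has_sum S) UNIV" using summable_exp_abs_int[OF e] by (auto simp: summable_on_def)
  have "(\<lambda>p. ?a (fst p) * ?a (snd p)) summable_on (SIGMA m:UNIV. UNIV)"
  proof (rule summable_on_SigmaI)
    show "((\<lambda>n. ?a (fst (m, n)) * ?a (snd (m, n))) has_sum ?a m * S) UNIV" for m
      using has_sum_cmult_right[OF S, of "?a m"] by simp
    show "(\<lambda>m. ?a m * S) summable_on UNIV"
      using summable_exp_abs_int[OF e] by (rule summable_on_cmult_left)
  qed simp
  hence "(\<lambda>p. exp (1 / c) * (?a (fst p) * ?a (snd p))) summable_on UNIV"
    by (intro summable_on_cmult_right) simp
  hence sm: "(\<lambda>p. cmod (?g p) * exp (- c * (cmod (?g p))\<^sup>2)) summable_on UNIV"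
  proof (rule summable_on_comparison_test)
    fix p :: "int \<times> int"
    obtain m n where p: "p = (m, n)" by (cases p)
    define x where "x = cmod (of_int m + of_int n * z)"
    have "\<bar>of_int m\<bar> + \<bar>of_int n\<bar> \<le> K * x" using K(2) by (simp add: x_def)
    hence le: "e * \<bar>of_int m\<bar> + e * \<bar>of_int n\<bar> \<le> x" using K(1) by (simp add: e_def field_simps)
    have "x \<le> exp x" using exp_ge_add_one_self[of x] by linarith
    hence "x * exp (- c * x\<^sup>2) \<le> exp x * exp (- c * x\<^sup>2)" by (intro mult_right_mono) auto
    also have "\<dots> = exp (x - c * x\<^sup>2)" by (simp flip: exp_add)
    also have "\<dots> \<le> exp (1 / c - x)"
    proof -
      \<comment> \<open>Completing the square yields \<open>x - c x^2 <= 1 / c - x\<close>.\<close>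
      have "0 \<le> (c * x - 1)\<^sup>2 / c" using assms(2) by simp
      also have "(c * x - 1)\<^sup>2 / c = c * x\<^sup>2 - 2 * x + 1 / c"
        using assms(2) by (simp add: field_simps power2_eq_square)
      finally show ?thesis by simp
    qed
    also have "\<dots> \<le> exp (1 / c - (e * \<bar>of_int m\<bar> + e * \<bar>of_int n\<bar>))" using le by simp
    also have "\<dots> = exp (1 / c) * (?a m * ?a n)" by (simp add: algebra_simps flip: exp_add)
    finally show "cmod (?g p) * exp (- c * (cmod (?g p))\<^sup>2) \<le> exp (1 / c) * (?a (fst p) * ?a (snd p))"
      by (simp add: p x_def)
  qed auto
  have "inj ?g"
  proof (rule injI)
    fix p q assume "?g p = ?g q"
    hence "complex_of_int (fst p) + of_int (snd p) * z = of_int (fst q) + of_int (snd q) * z"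
      by (simp add: case_prod_beta)
    from latt_coord_unique[OF _ this] show "p = q" using assms(1) by (simp add: prod_eq_iff)
  qed
  hence "(\<lambda>u. cmod u * exp (- c * (cmod u)\<^sup>2)) summable_on range ?g"
    using sm by (subst summable_on_reindex) (auto simp: o_def)
  also have "range ?g = latt z" by (auto simp: latt_def)
  finally show ?thesis .
qed

section \<open>Units and fibres\<close>

text \<open>Phrased as the stabiliser of \<open>OK D\<close>, the form in which units decide when
  two multiples of an invertible module coincide.\<close>

definition OK_units :: "int \<Rightarrow> complex set" where
  "OK_units D = {s. smul s (OK D) = OK D}"

lemma cnj_image_OK: "cnj ` OK D = OK D"
proof -
  have "cnj ` OK D \<subseteq> OK D" using cnj_mem_OK by blast
  moreover from image_mono[OF this, of cnj] have "OK D \<subseteq> cnj ` OK D" by simp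
  ultimately show ?thesis by blast
qed

text \<open>A unit scales \<open>OK D\<close> to itself, so the norm formula gives it absolute value
  1, and a bounded region contains only finitely many lattice points.\<close>

lemma OK_units:
  assumes "fund_disc D"
  shows "finite (OK_units D)" "1 \<in> OK_units D" "s \<in> OK_units D \<Longrightarrow> s \<noteq> 0"
proof -
  note om = cm_point_om[OF assms]
  show "1 \<in> OK_units D" by (simp add: OK_units_def)
  show nz: "s \<noteq> 0" if "s \<in> OK_units D" for s
  proof
    assume "s = 0"
    hence "OK D \<subseteq> {0}" using that by (auto simp: OK_units_def smul_def)
    thus False using OK_ring(1)[OF assms] by auto
  qed
  \<comment> \<open>At the point \<open>om D\<close> the inverse lattice is \<open>OK D\<close>
    itself, so the norm formula covers principal ideals.\<close>
  have inv: "inv_latt 1 (om D) = OK D"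
    using cnj_image_OK[of D] by (simp add: inv_latt_def OK_eq_latt)
  have norm: "real (idl_norm D (smul s (OK D))) = (cmod s)\<^sup>2" if "s \<in> OK D" "s \<noteq> 0" for s
    using idl_norm_smul_inv_latt[OF assms om] that unfolding inv OK_eq_latt[symmetric] by simp
  have "OK_units D \<subseteq> {s \<in> OK D. cmod s \<le> 1}"
  proof
    fix s assume s: "s \<in> OK_units D"
    have sO: "s \<in> OK D"
      using smul_memI[OF OK_ring(1)[OF assms], of s] s by (simp add: OK_units_def)
    have "smul s (OK D) = smul 1 (OK D)" using s by (simp add: OK_units_def)
    hence "(cmod s)\<^sup>2 = (cmod 1)\<^sup>2"
      using norm[OF sO nz[OF s]] norm[OF OK_ring(1)[OF assms]] by simp
    hence "cmod s = 1" by (simp add: power2_eq_1_iff) (metis norm_ge_zero neg_0_le_iff_le not_one_le_zero)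
    thus "s \<in> {s \<in> OK D. cmod s \<le> 1}" using sO by simp
  qed
  moreover have "finite {s \<in> OK D. cmod s \<le> 1}"
    unfolding OK_eq_latt by (rule finite_latt_bounded[OF Im_om_pos[OF fund_disc_neg[OF assms]]])
  ultimately show "finite (OK_units D)" by (rule finite_subset)
qed

text \<open>Multiplication by \<open>latt z\<close> cancels \<open>inv_latt A z\<close>, and
  multiplication by \<open>inv_latt A z\<close> restores it.\<close>

lemma smul_inv_latt_eq_iff:
  assumes "cm_point D z A B C" "w \<noteq> 0"
  shows "smul w' (inv_latt A z) = smul w (inv_latt A z) \<longleftrightarrow> w' / w \<in> OK_units D"
proof
  let ?N = "inv_latt A z"
  note N = OK_module_inv_latt[OF assms(1)]
  {
    assume "smul w' ?N = smul w ?N"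
    hence "idl_mult (smul w' ?N) (latt z) = idl_mult (smul w ?N) (latt z)" by simp
    hence "smul w' (OK D) = smul w (OK D)"
      unfolding idl_mult_smul_left idl_mult_comm[of ?N] latt_inv_latt[OF assms(1)] .
    hence "smul (inverse w) (smul w' (OK D)) = smul (inverse w) (smul w (OK D))" by simp
    hence "smul (w' / w) (OK D) = OK D"
      using assms(2) by (simp add: smul_smul divide_inverse mult.commute)
    thus "w' / w \<in> OK_units D" by (simp add: OK_units_def)
  next
    assume "w' / w \<in> OK_units D"
    hence "idl_mult (smul (w' / w) (OK D)) ?N = idl_mult (OK D) ?N" by (simp add: OK_units_def)
    hence "smul (w' / w) ?N = ?N" unfolding idl_mult_smul_left idl_mult_OK_left[OF N] .
    hence "smul w (smul (w' / w) ?N) = smul w ?N" by simp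
    thus "smul w' ?N = smul w ?N" using assms(2) by (simp add: smul_smul)
  }
qed

text \<open>Index set of the nonzero terms of all classes together; \<open>pair_ideal\<close> maps
  it onto the integral ideals, with fibres of constant size.\<close>

definition class_pairs :: "nat \<Rightarrow> (nat \<Rightarrow> complex) \<Rightarrow> (nat \<times> complex) set" where
  "class_pairs h z = (SIGMA a:{1..h}. latt (z a) - {0})"

definition pair_ideal :: "(nat \<Rightarrow> int) \<Rightarrow> (nat \<Rightarrow> complex) \<Rightarrow> nat \<times> complex \<Rightarrow> complex set" where
  "pair_ideal A z p = smul (snd p) (inv_latt (A (fst p)) (z (fst p)))"

text \<open>The class of the ideal fixes \<open>a\<close>, and \<open>w\<close> is fixed up to a
  unit.\<close>

lemma card_fibre:
  assumes "fund_disc D" "CM_reps D h z" "\<forall>a\<in>{1..h}. prim_eq (z a) (A a) (B a) (C a)"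
    "integral_ideal D I"
  shows "card {p \<in> class_pairs h z. pair_ideal A z p = I} = card (OK_units D)"
    "finite {p \<in> class_pairs h z. pair_ideal A z p = I}"
proof -
  obtain a w where aw: "a \<in> {1..h}" "w \<in> latt (z a)" "w \<noteq> 0" "I = smul w (inv_latt (A a) (z a))"
    using CM_reps_cover[OF assms] .
  have cm: "cm_point D (z b) (A b) (B b) (C b)" if "b \<in> {1..h}" for b
    by (rule CM_reps_cm_point[OF assms(1,2) that]) (use assms(3) that in blast)
  let ?F = "{p \<in> class_pairs h z. pair_ideal A z p = I}"
  have "?F = (\<lambda>s. (a, s * w)) ` OK_units D"
  proof
    show "?F \<subseteq> (\<lambda>s. (a, s * w)) ` OK_units D"
    proof
      fix p assume p: "p \<in> ?F"
      obtain b w' where bw: "p = (b, w')" by (cases p)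
      have b: "b \<in> {1..h}" "w' \<noteq> 0" "smul w' (inv_latt (A b) (z b)) = smul w (inv_latt (A a) (z a))"
        using p aw(4) by (auto simp: bw class_pairs_def pair_ideal_def)
      have "b = a"
        by (rule CM_reps_unique[OF assms(2) b(1) aw(1) _ _ b(2) aw(3) b(3)])
           (use cm_pointD(3)[OF cm[OF b(1)]] cm_pointD(3)[OF cm[OF aw(1)]] in auto)
      hence "w' / w \<in> OK_units D" using b(3) smul_inv_latt_eq_iff[OF cm[OF aw(1)] aw(3)] by simp
      moreover have "p = (a, (w' / w) * w)" using aw(3) bw \<open>b = a\<close> by simp
      ultimately show "p \<in> (\<lambda>s. (a, s * w)) ` OK_units D" by blast
    qed
    show "(\<lambda>s. (a, s * w)) ` OK_units D \<subseteq> ?F"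
    proof
      fix p assume "p \<in> (\<lambda>s. (a, s * w)) ` OK_units D"
      then obtain s where s: "s \<in> OK_units D" "p = (a, s * w)" by blast
      have sw: "s * w \<noteq> 0" using OK_units(3)[OF assms(1) s(1)] aw(3) by simp
      have eq: "smul (s * w) (inv_latt (A a) (z a)) = I"
        unfolding aw(4) smul_inv_latt_eq_iff[OF cm[OF aw(1)] aw(3)] using s(1) aw(3) by simp
      hence "s * w \<in> latt (z a)"
        using integral_ideal_smul_inv_latt[OF cm[OF aw(1)] sw] assms(4) by simp
      thus "p \<in> ?F" using eq sw aw(1) by (simp add: s(2) class_pairs_def pair_ideal_def)
    qed
  qed
  moreover have "inj_on (\<lambda>s. (a, s * w)) (OK_units D)" using aw(3) by (auto simp: inj_on_def)
  ultimately show "card ?F = card (OK_units D)" "finite ?F"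
    using OK_units(1)[OF assms(1)] by (simp_all add: card_image)
qed

section \<open>Theta functions of the lattices\<close>

lemma f_theta_term:
  assumes "cm_point D z A B C"
  shows "exp (pi * \<i> * of_nat f * of_int \<bar>D\<bar> * \<tau> * complex_of_real (bil f A B C y y))
    = exp (2 * pi * \<i> * \<tau> * of_real (of_int A * (cmod (dev D f z y))\<^sup>2))"
proof -
  have "pi * \<i> * of_nat f * of_int \<bar>D\<bar> * \<tau> * complex_of_real (bil f A B C y y)
     = pi * \<i> * \<tau> * complex_of_real (of_nat f * of_int \<bar>D\<bar> * bil f A B C y y)"
    by (simp only: of_real_mult of_real_of_nat_eq of_real_of_int_eq mult_ac)
  also have "\<dots> = 2 * pi * \<i> * \<tau> * of_real (of_int A * (cmod (dev D f z y))\<^sup>2)"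
    unfolding bil_eq_norm_dev[OF assms] by simp
  finally show ?thesis by (rule arg_cong)
qed

lemma Omega'_eq_dev:
  assumes "cm_point D z A B C" "f > 0"
  shows "Omega' f A z y = complex_of_real (sqrt (2 * of_int A * of_nat f)) / (of_nat f * sqrtD D) * dev D f z y"
  using assms(2) sqrtD_nonzero[OF cm_pointD(4)[OF assms(1)]] by (simp add: Omega'_def dev_def)

text \<open>\<open>dev\<close> maps the dual lattice injectively into \<open>latt z\<close>, where
  the norms of the terms become, up to a constant factor, those of
  \<open>summable_latt_gauss\<close>.\<close>

lemma summable_f_theta:
  assumes "cm_point D z A B C" "f > 0" "Im \<tau> > 0"
  shows "(\<lambda>y. Omega' f A z y *
                 exp (pi * \<i> * of_nat f * of_int \<bar>D\<bar> * \<tau> * complex_of_real (bil f A B C y y)))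
    summable_on Lam_dual f A B C"
proof -
  note c = cm_pointD[OF assms(1)]
  define k where "k = complex_of_real (sqrt (2 * of_int A * of_nat f)) / (of_nat f * sqrtD D)"
  let ?g = "\<lambda>u. u * exp (2 * pi * \<i> * \<tau> * of_real (of_int A * (cmod u)\<^sup>2))"
  define e where "e = 2 * pi * Im \<tau> * of_int A"
  have "e > 0" using assms(3) c(3) by (simp add: e_def)
  have "norm (?g u) = cmod u * exp (- e * (cmod u)\<^sup>2)" for u
    by (simp add: norm_mult e_def mult_ac)
  hence "(\<lambda>u. norm (?g u)) summable_on latt z"
    using summable_latt_gauss[OF c(1) \<open>e > 0\<close>] by simp
  hence "?g summable_on latt z" by (rule abs_summable_summable)
  moreover have "dev D f z ` Lam_dual f A B C \<subseteq> latt z" using Lam_dual_iff[OF assms(1), of _ f] by blast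
  ultimately have "?g summable_on dev D f z ` Lam_dual f A B C" by (rule summable_on_subset)
  hence "(\<lambda>y. ?g (dev D f z y)) summable_on Lam_dual f A B C"
    using inj_on_subset[OF inj_dev[OF assms(1,2)] subset_UNIV]
    by (subst (asm) summable_on_reindex) (auto simp: o_def)
  hence "(\<lambda>y. k * ?g (dev D f z y)) summable_on Lam_dual f A B C" by (rule summable_on_cmult_right)
  thus ?thesis
    unfolding f_theta_term[OF assms(1)] Omega'_eq_dev[OF assms(1,2)] k_def by (simp only: mult.assoc)
qed

text \<open>The dual lattice is the disjoint union of finitely many cosets, and the coefficient is
  constant on each of them.\<close>

lemma f_theta_combination_has_sum:
  assumes "fund_disc D" "cm_point D z A B C" "f > 0" "Im \<tau> > 0"
  shows "((\<lambda>y. coef (coset y) * (Omega' f A z y *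
      exp (2 * pi * \<i> * \<tau> * of_real (of_int A * (cmod (dev D f z y))\<^sup>2)))) has_sum
      (\<Sum>\<beta>\<in>disc_grp f A B C. coef \<beta> * f_theta D f A B C z \<tau> \<beta>)) (Lam_dual f A B C)"
proof -
  let ?P = "\<lambda>y. Omega' f A z y * exp (2 * pi * \<i> * \<tau> * of_real (of_int A * (cmod (dev D f z y))\<^sup>2))"
  let ?L = "Lam_dual f A B C"
  have sm: "?P summable_on ?L"
    using summable_f_theta[OF assms(2-4)] unfolding f_theta_term[OF assms(2)] .
  have coset: "coset y = \<beta>" if "\<beta> \<in> disc_grp f A B C" "y \<in> \<beta>" for y \<beta>
    using that coset_eqI unfolding disc_grp_def by blast
  have "((\<lambda>y. coef (coset y) * ?P y) has_sum (\<Sum>\<beta>\<in>disc_grp f A B C. coef \<beta> * f_theta D f A B C z \<tau> \<beta>))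
     (\<Union>\<beta>\<in>disc_grp f A B C. ?L \<inter> \<beta>)"
  proof (rule sum_has_sum)
    show "finite (disc_grp f A B C)" by (rule card_disc_grp(1)[OF assms(1-3)])
  next
    fix \<beta> assume \<beta>: "\<beta> \<in> disc_grp f A B C"
    have "?P summable_on (?L \<inter> \<beta>)" by (rule summable_on_subset[OF sm]) simp
    hence "(?P has_sum f_theta D f A B C z \<tau> \<beta>) (?L \<inter> \<beta>)"
      unfolding f_theta_def f_theta_term[OF assms(2)] by (rule has_sum_infsum)
    hence "((\<lambda>y. coef \<beta> * ?P y) has_sum (coef \<beta> * f_theta D f A B C z \<tau> \<beta>)) (?L \<inter> \<beta>)"
      by (rule has_sum_cmult_right)
    also have "?this \<longleftrightarrow> ((\<lambda>y. coef (coset y) * ?P y) has_sum (coef \<beta> * f_theta D f A B C z \<tau> \<beta>)) (?L \<inter> \<beta>)"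
      by (rule has_sum_cong) (use coset[OF \<beta>] in simp)
    finally show "((\<lambda>y. coef (coset y) * ?P y) has_sum (coef \<beta> * f_theta D f A B C z \<tau> \<beta>)) (?L \<inter> \<beta>)" .
  next
    fix \<beta> \<beta>' assume "\<beta> \<in> disc_grp f A B C" "\<beta>' \<in> disc_grp f A B C" "\<beta> \<noteq> \<beta>'"
    thus "?L \<inter> \<beta> \<inter> (?L \<inter> \<beta>') = {}" using coset by blast
  qed
  also have "(\<Union>\<beta>\<in>disc_grp f A B C. ?L \<inter> \<beta>) = ?L"
    unfolding disc_grp_def using self_mem_coset by blast
  finally show ?thesis .
qed

theorem theorem3p3p10:
  fixes D :: int and f :: nat and h :: nat and z :: "nat \<Rightarrow> complex"
    and A B C :: "nat \<Rightarrow> int"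
    and cf :: "complex set" and \<phi> :: "complex set \<Rightarrow> complex"
  assumes "fund_disc D"
    and "f > 0"
    and "CM_reps D h z"
    and "\<forall>a\<in>{1..h}. prim_eq (z a) (A a) (B a) (C a)"
    and "hecke_char D cf \<phi>"
    and "idl_dvd D cf (cbar D f)"
  shows "\<exists>coef :: nat \<Rightarrow> (real \<times> real) set \<Rightarrow> complex.
     (\<forall>\<tau>. Im \<tau> > 0 \<longrightarrow>
        hecke_theta D cf \<phi> \<tau> =
          (\<Sum>a\<in>{1..h}. \<Sum>\<beta>\<in>disc_grp f (A a) (B a) (C a).
              coef a \<beta> * f_theta D f (A a) (B a) (C a) (z a) \<tau> \<beta>)) \<and>
     (\<forall>a\<in>{1..h}. \<forall>\<beta>\<in>disc_grp f (A a) (B a) (C a). coef a \<beta> \<noteq> 0 \<longrightarrow>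
        (\<exists>q. integral_ideal D q \<and> idl_dvd D q (cbar D f) \<and> coprime_idl D q cf \<and>
             \<beta> \<in> orb D f (A a) (B a) (C a) (z a) q))"
proof -
  define N where "N a = inv_latt (A a) (z a)" for a
  define W where "W a = dev D f (z a)" for a
  define L where "L a = Lam_dual f (A a) (B a) (C a)" for a
  \<comment> \<open>\<open>u\<close> is the multiplicity with which each ideal occurs among the
    pairs, \<open>k a\<close> the constant ratio of \<open>Omega'\<close> to
    \<open>dev\<close>.\<close>
  define u where "u = complex_of_nat (card (OK_units D))"
  define k where "k a = complex_of_real (sqrt (2 * of_int (A a) * of_nat f)) / (of_nat f * sqrtD D)" for a
  \<comment> \<open>Vectors whose ideal is nonzero and prime to \<open>cf\<close>; any of them can
    define the coefficient of its coset.\<close>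
  define good where "good a y \<longleftrightarrow> y \<in> L a \<and> W a y \<noteq> 0 \<and> coprime_idl D (smul (W a y) (N a)) cf" for a y
  define rep where "rep a \<beta> = (SOME y. y \<in> \<beta> \<and> good a y)" for a \<beta>
  \<comment> \<open>The quotient of \<open>\<phi> (w N)\<close> by \<open>w\<close> at the chosen
    vector, corrected by \<open>k a\<close> and \<open>u\<close>. Cosets without good vectors get 0,
    which yields the support condition.\<close>
  define coef where "coef a \<beta> = (if \<exists>y. y \<in> \<beta> \<and> good a y
      then \<phi> (smul (W a (rep a \<beta>)) (N a)) / (W a (rep a \<beta>) * k a * u) else 0)" for a \<beta>
  have D: "D < 0" using fund_disc_neg[OF assms(1)] .
  have cf: "integral_ideal D cf" using assms(5) by (simp add: hecke_char_def)
  have csub: "cbar D f \<subseteq> cf" by (rule cbar_subset[OF assms(1) cf assms(6)])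
  have u0: "u \<noteq> 0"
    unfolding u_def using OK_units(1,2)[OF assms(1)] by (auto simp: card_eq_0_iff)
  have cm: "cm_point D (z a) (A a) (B a) (C a)" if "a \<in> {1..h}" for a
    by (rule CM_reps_cm_point[OF assms(1,3) that]) (use assms(4) that in blast)
  have k0: "k a \<noteq> 0" if "a \<in> {1..h}" for a
    using assms(2) cm_pointD(3)[OF cm[OF that]] sqrtD_nonzero[OF D] by (simp add: k_def)
  have L: "y \<in> L a \<longleftrightarrow> W a y \<in> latt (z a)" if "a \<in> {1..h}" for a y
    unfolding L_def W_def by (rule Lam_dual_iff[OF cm[OF that]])
  have rep: "rep a \<beta> \<in> \<beta> \<and> good a (rep a \<beta>)" if "y \<in> \<beta>" "good a y" for a \<beta> y
    unfolding rep_def by (rule someI[of _ y]) (use that in simp)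
  \<comment> \<open>Each vector contributes the term of its ideal divided by \<open>u\<close>: by
    \<open>hecke_char_ratio\<close> the choice of \<open>rep\<close> does not matter, and where
    \<open>W a y\<close> is 0, so is \<open>Omega'\<close>.\<close>
  have key: "coef a (coset y) * Omega' f (A a) (z a) y =
      (if W a y = 0 then 0 else (if coprime_idl D (smul (W a y) (N a)) cf
        then \<phi> (smul (W a y) (N a)) else 0) / u)" if a: "a \<in> {1..h}" and y: "y \<in> L a" for a y
  proof -
    have Om: "Omega' f (A a) (z a) y = k a * W a y"
      unfolding k_def W_def by (rule Omega'_eq_dev[OF cm[OF a] assms(2)])
    have yl: "W a y \<in> latt (z a)" using y L[OF a] by simp
    show ?thesis
    proof (cases "\<exists>x. x \<in> coset y \<and> good a x")
      case True
      define r where "r = rep a (coset y)"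
      have r: "r \<in> coset y" "good a r" using True rep unfolding r_def by blast+
      have rl: "W a r \<in> latt (z a)" "W a r \<noteq> 0" "coprime_idl D (smul (W a r) (N a)) cf"
        using r(2) L[OF a] unfolding good_def by blast+
      have "y \<in> coset r" using coset_eqI[OF r(1)] self_mem_coset[of y] by simp
      hence d: "W a y - W a r \<in> smul (of_nat f * sqrtD D) (latt (z a))"
        unfolding W_def by (rule dev_coset)
      \<comment> \<open>One good vector makes coprimality hold throughout its coset.\<close>
      have cop: "coprime_idl D (smul (W a y) (N a)) cf"
        unfolding N_def
        by (rule coprime_shift[OF assms(1) cm[OF a] cf csub rl(1) yl d rl(3)[unfolded N_def]])
      have c: "coef a (coset y) = \<phi> (smul (W a r) (N a)) / (W a r * k a * u)"
        unfolding coef_def r_def using True by simp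
      show ?thesis
      proof (cases "W a y = 0")
        case False
        have "\<phi> (smul (W a y) (N a)) * W a r = \<phi> (smul (W a r) (N a)) * W a y"
          unfolding N_def
          by (rule hecke_char_ratio[OF assms(1,3,4,5) csub cm[OF a] rl(1) yl rl(2) False d
                rl(3)[unfolded N_def]])
        thus ?thesis using False cop rl(2) k0[OF a] u0 by (simp add: c Om field_simps)
      qed (simp add: Om)
    next
      case False
      hence "\<not> good a y" using self_mem_coset by blast
      hence "W a y = 0 \<or> \<not> coprime_idl D (smul (W a y) (N a)) cf" using y by (simp add: good_def)
      moreover have "coef a (coset y) = 0" unfolding coef_def by (rule if_not_P[OF False])
      ultimately show ?thesis by auto
    qed
  qed
  have "hecke_theta D cf \<phi> \<tau> = (\<Sum>a\<in>{1..h}. \<Sum>\<beta>\<in>disc_grp f (A a) (B a) (C a).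
              coef a \<beta> * f_theta D f (A a) (B a) (C a) (z a) \<tau> \<beta>)" if \<tau>: "Im \<tau> > 0" for \<tau>
  proof -
    define g where "g I = (if coprime_idl D I cf then \<phi> I else 0) *
                  exp (2 * pi * \<i> * \<tau> * of_nat (idl_norm D I))" for I
    define S where "S a = (\<Sum>\<beta>\<in>disc_grp f (A a) (B a) (C a).
              coef a \<beta> * f_theta D f (A a) (B a) (C a) (z a) \<tau> \<beta>)" for a
    \<comment> \<open>Contribution of one class: the dual vectors are replaced by their images under
      \<open>dev\<close>, which run through \<open>latt (z a)\<close>.\<close>
    have Sa: "((\<lambda>w. g (smul w (N a)) / u) has_sum S a) (latt (z a) - {0})" if a: "a \<in> {1..h}" for a
    proof -
      \<comment> \<open>The point 0 corresponds to no ideal; its value 0 allows it to be dropped at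
        the end.\<close>
      let ?G = "\<lambda>w. if w = 0 then 0 else g (smul w (N a)) / u"
      have "((\<lambda>y. coef a (coset y) * (Omega' f (A a) (z a) y *
          exp (2 * pi * \<i> * \<tau> * of_real (of_int (A a) * (cmod (W a y))\<^sup>2)))) has_sum S a) (L a)"
        unfolding W_def L_def S_def by (rule f_theta_combination_has_sum[OF assms(1) cm[OF a] assms(2) \<tau>])
      also have "?this \<longleftrightarrow> ((\<lambda>y. ?G (W a y)) has_sum S a) (L a)"
      proof (rule has_sum_cong)
        fix y assume y: "y \<in> L a"
        show "coef a (coset y) * (Omega' f (A a) (z a) y *
          exp (2 * pi * \<i> * \<tau> * of_real (of_int (A a) * (cmod (W a y))\<^sup>2))) = ?G (W a y)"
        proof (cases "W a y = 0")
          case True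
          thus ?thesis using key[OF a y] by simp
        next
          case False
          have "W a y \<in> latt (z a)" using y L[OF a] by simp
          from idl_norm_smul_inv_latt[OF assms(1) cm[OF a] this False]
          have "complex_of_real (real (idl_norm D (smul (W a y) (N a)))) =
              of_real (of_int (A a) * (cmod (W a y))\<^sup>2)" unfolding N_def by simp
          hence n: "of_real (of_int (A a) * (cmod (W a y))\<^sup>2) =
              complex_of_nat (idl_norm D (smul (W a y) (N a)))" by simp
          show ?thesis unfolding n mult.assoc[symmetric] key[OF a y] using False by (simp add: g_def)
        qed
      qed
      also have "\<dots> \<longleftrightarrow> (?G has_sum S a) (latt (z a))"
      proof (rule has_sum_reindex_bij_betw)
        have "inj_on (W a) (L a)"
          unfolding W_def using inj_on_subset[OF inj_dev[OF cm[OF a] assms(2)] subset_UNIV] .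
        moreover have "W a ` L a = latt (z a)"
        proof
          show "W a ` L a \<subseteq> latt (z a)" using L[OF a] by blast
          show "latt (z a) \<subseteq> W a ` L a"
          proof
            fix v assume v: "v \<in> latt (z a)"
            obtain y where "v = W a y"
              unfolding W_def using surj_dev[OF cm[OF a] assms(2)] by (rule surjE)
            thus "v \<in> W a ` L a" using v L[OF a] by blast
          qed
        qed
        ultimately show "bij_betw (W a) (L a) (latt (z a))" by (simp add: bij_betw_def)
      qed
      also have "\<dots> \<longleftrightarrow> ((\<lambda>w. g (smul w (N a)) / u) has_sum S a) (latt (z a) - {0})"
        by (rule has_sum_cong_neutral) auto
      finally show ?thesis .
    qed
    have "((\<lambda>p. g (pair_ideal A z p) / u) has_sum sum S {1..h}) (\<Union>a\<in>{1..h}. Pair a ` (latt (z a) - {0}))"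
    proof (rule sum_has_sum)
      fix a assume a: "a \<in> {1..h}"
      have "inj_on (Pair a) (latt (z a) - {0})" by (simp add: inj_on_def)
      thus "((\<lambda>p. g (pair_ideal A z p) / u) has_sum S a) (Pair a ` (latt (z a) - {0}))"
        using Sa[OF a] by (simp add: has_sum_reindex o_def pair_ideal_def N_def)
    qed auto
    also have "(\<Union>a\<in>{1..h}. Pair a ` (latt (z a) - {0})) = class_pairs h z"
      by (auto simp: class_pairs_def)
    finally have pairs: "((\<lambda>p. g (pair_ideal A z p) / u) has_sum sum S {1..h}) (class_pairs h z)" .
    let ?F = "\<lambda>I. {p \<in> class_pairs h z. pair_ideal A z p = I}"
    \<comment> \<open>The pairs are regrouped by the ideal that they represent.\<close>
    have "bij_betw snd (SIGMA I:{I. integral_ideal D I}. ?F I) (class_pairs h z)"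
      unfolding bij_betw_def
    proof
      show "inj_on snd (SIGMA I:{I. integral_ideal D I}. ?F I)" by (auto simp: inj_on_def)
      show "snd ` (SIGMA I:{I. integral_ideal D I}. ?F I) = class_pairs h z"
      proof
        show "class_pairs h z \<subseteq> snd ` (SIGMA I:{I. integral_ideal D I}. ?F I)"
        proof
          fix p assume p: "p \<in> class_pairs h z"
          hence q: "fst p \<in> {1..h}" "snd p \<in> latt (z (fst p))" "snd p \<noteq> 0"
            by (auto simp: class_pairs_def)
          have "integral_ideal D (pair_ideal A z p)"
            unfolding pair_ideal_def integral_ideal_smul_inv_latt[OF cm[OF q(1)] q(3)] by (rule q(2))
          hence "(pair_ideal A z p, p) \<in> (SIGMA I:{I. integral_ideal D I}. ?F I)" using p by blast
          thus "p \<in> snd ` (SIGMA I:{I. integral_ideal D I}. ?F I)" by (rule image_eqI[rotated]) simp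
        qed
      qed auto
    qed
    from has_sum_reindex_bij_betw[OF this, THEN iffD2, OF pairs]
    have "((\<lambda>q. g (pair_ideal A z (snd q)) / u) has_sum sum S {1..h}) (SIGMA I:{I. integral_ideal D I}. ?F I)" .
    hence "(g has_sum sum S {1..h}) {I. integral_ideal D I}"
    proof (rule has_sum_SigmaD)
      fix I assume "I \<in> {I. integral_ideal D I}"
      hence I: "integral_ideal D I" by simp
      note fib = card_fibre[OF assms(1,3,4) I]
      \<comment> \<open>All terms of a fibre are equal and there are \<open>u\<close> of them, which
        cancels the denominator.\<close>
      have "(\<Sum>p\<in>?F I. g (pair_ideal A z (snd (I, p))) / u) = (\<Sum>p\<in>?F I. g I / u)"
        by (rule sum.cong) auto
      also have "\<dots> = g I" using fib(1) u0 by (simp add: u_def)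
      finally show "((\<lambda>p. g (pair_ideal A z (snd (I, p))) / u) has_sum g I) (?F I)"
        by (intro has_sum_finiteI fib(2)) simp
    qed
    thus ?thesis unfolding hecke_theta_def g_def S_def by (rule infsumI)
  qed
  \<comment> \<open>Support condition: a nonzero coefficient means that the coset has a good
    vector.\<close>
  moreover have "\<exists>q. integral_ideal D q \<and> idl_dvd D q (cbar D f) \<and> coprime_idl D q cf \<and>
             \<beta> \<in> orb D f (A a) (B a) (C a) (z a) q"
    if a: "a \<in> {1..h}" and \<beta>: "\<beta> \<in> disc_grp f (A a) (B a) (C a)" "coef a \<beta> \<noteq> 0" for a \<beta>
  proof -
    obtain y where y: "y \<in> \<beta>" "good a y" using \<beta>(2) unfolding coef_def by (auto split: if_splits)
    obtain x where x: "\<beta> = coset x" "x \<in> L a" using \<beta>(1) unfolding disc_grp_def L_def by blast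
    have \<beta>y: "\<beta> = coset y" using coset_eqI[of y x] x(1) y(1) by simp
    \<comment> \<open>\<open>annih\<close> is evaluated at this choice, which may differ from the
      good vector \<open>y\<close> and may even be mapped to 0; coprimality is carried over from
      \<open>y\<close>.\<close>
    define s where "s = (SOME y. y \<in> \<beta>)"
    have s: "s \<in> \<beta>" unfolding s_def using y(1) by (rule someI)
    have "s \<in> L a"
      using s coset_subset_Lam_dual[OF assms(1) cm[OF a] x(2)[unfolded L_def]] unfolding x(1) L_def by blast
    hence sl: "W a s \<in> latt (z a)" using L[OF a] by simp
    have "W a s - W a y \<in> smul (of_nat f * sqrtD D) (latt (z a))"
      unfolding W_def by (rule dev_coset) (use s \<beta>y in simp)
    moreover have "W a y \<in> latt (z a)" "coprime_idl D (smul (W a y) (N a)) cf"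
      using y(2) L[OF a] unfolding good_def by blast+
    ultimately have "coprime_idl D (smul (W a s) (N a)) cf"
      unfolding N_def by (intro coprime_shift[OF assms(1) cm[OF a] cf csub _ sl])
    from annihilator_times_gcd[OF assms(1,2) cm[OF a] cf csub sl this[unfolded N_def]]
    obtain q where q: "integral_ideal D q" "idl_dvd D q (cbar D f)" "coprime_idl D q cf"
      "idl_mult {\<alpha> \<in> OK D. \<alpha> * W a s \<in> (\<lambda>v. of_nat f * sqrtD D * v) ` latt (z a)} q = cbar D f"
      by blast
    have "annih D f (A a) (B a) (C a) (z a) \<beta> =
        {\<alpha> \<in> OK D. \<alpha> * W a s \<in> (\<lambda>v. of_nat f * sqrtD D * v) ` latt (z a)}"
      unfolding annih_def Omega_eq_dev[OF assms(1) cm[OF a] assms(2)] s_def W_def ..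
    hence "\<beta> \<in> orb D f (A a) (B a) (C a) (z a) q" unfolding orb_def using \<beta>(1) q(4) by simp
    thus ?thesis using q by blast
  qed
  ultimately show ?thesis by (intro exI[of _ coef]) simp
qed

end
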